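(* Let $G=(V,E)$ be a directed tree network with $V=\{v_0,\dots,v_n\}$, source $v_0$, inner vertices $V_I$, velocities $\lambda^{(i)}>0$ ($i=1,\dots,n$) and distribution parameters $\alpha_{i,k}>0$ ($v_i\in V_I$, $(k)\in E^+(i)$) as described in the context, and let $\mathcal T=(0,T)$, $\Omega=(0,\omega)$ with $T,\omega>0$. For each $u\in L^2(\mathcal T)$, the function $z:=(z^{(1)},\dots,z^{(n)})\in C(\overline\Omega,L^2(\mathcal T,\mathbb R^n))$ characterized, for all $x\in\overline\Omega$ and almost every $t\in\mathcal T$, by $$z^{(1)}(t,x)=\begin{cases}\frac{1}{\lambda^{(1)}}\,u(t-x/\lambda^{(1)}) & \text{if } t-x/\lambda^{(1)}>0,\\ 0 & \text{if } t-x/\lambda^{(1)}\le 0,\end{cases}$$ and, recursively for each $v_i\in V_I$ and $(k)\in E^+(i)$, by $$z^{(k)}(t,x)=\begin{cases}\alpha_{i,k}\frac{\lambda^{(i)}}{\lambda^{(k)}}\,z^{(i)}(t-x/\lambda^{(k)},\omega) & \text{if } t-x/\lambda^{(k)}>0,\\ 0 & \text{if } t-x/\lambda^{(k)}\le 0,\end{cases}$$ is the uniquely determined weak solution of the network conservation law with inflow $u$ (in the sense defined in the context). Additionally, there is a constant $\kappa>0$, not depending on $u$, such that $$\|z\|_{C(\overline\Omega,L^2(\mathcal T,\mathbb R^n))}\le\kappa\,\|u\|_{L^2(\mathcal T)}.$$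
   Context: Network. $G=(V,E)$ is a directed graph which is a tree (the underlying undirected graph is connected and has no cycles), $V=\{v_0,\dots,v_n\}$, $|E|=n$. The unique source vertex is $v_0$ (the only vertex without incoming edge); exactly one edge leaves $v_0$, and it ends at $v_1$. Every $v_i$ with $i\ge1$ is the end of exactly one edge, which is denoted by $(i)$. $V_D\subset V$ is the set of vertices with no outgoing edges (demand vertices), $V_I:=V\setminus(V_D\cup\{v_0\})$ is the set of inner vertices, and $E^+(i)$ denotes the set of all edges starting at $v_i$. For each $i\in\{1,\dots,n\}$, $\lambda^{(i)}>0$ is a constant; for each $v_i\in V_I$ and $(k)\in E^+(i)$, $\alpha_{i,k}>0$ is a constant, with $\sum_{(k)\in E^+(i)}\alpha_{i,k}=1$. Network conservation law with inflow $u$ (formal statement): $z^{(i)}_t+\lambda^{(i)}z^{(i)}_x=0$ on $\mathcal T\times\Omega$ for $(i)\in E$; $z^{(i)}(0,x)=0$ on $\Omega$ for $(i)\in E$; $\lambda^{(1)}z^{(1)}(t,0)=u(t)$ on $\mathcal T$; $\lambda^{(k)}z^{(k)}(t,0)=\alpha_{i,k}\lambda^{(i)}z^{(i)}(t,\omega)$ on $\mathcal T$ for $v_i\in V_I$, $(k)\in E^+(i)$. Function space. $C(\overline\Omega,L^2(\mathcal T,\mathbb R^n))$ is the space of all functions $z:\mathcal T\times\overline\Omega\to\mathbb R^n$ such that $z(\cdot,x)\in L^2(\mathcal T,\mathbb R^n)$ for each $x\in\overline\Omega$ and $\overline\Omega\ni x\mapsto z(\cdot,x)\in L^2(\mathcal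 T,\mathbb R^n)$ is continuous, with the norm $\max_{x\in\overline\Omega}\|z(\cdot,x)\|_{L^2(\mathcal T,\mathbb R^n)}$. Weak solution. For $\tau\in\overline{\mathcal T}$ let $\mathcal T_\tau:=(0,\tau)$ and $$W_\tau:=\{\varphi\in C^1(\overline{\mathcal T_\tau\times\Omega}) \mid \varphi(\cdot,\omega)=0\text{ on }\overline{\mathcal T_\tau},\ \varphi(\tau,\cdot)=0\text{ on }\overline\Omega\}.$$ For $u\in L^2(\mathcal T)$, a function $z=(z^{(1)},\dots,z^{(n)})\in C(\overline\Omega,L^2(\mathcal T,\mathbb R^n))$ is a weak solution of the network conservation law with inflow $u$ if for all $\tau\in\overline{\mathcal T}$ and all $\varphi\in W_\tau$ $$\int_{\mathcal T_\tau}\int_\Omega z^{(1)}(t,x)\bigl(\varphi_t(t,x)+\lambda^{(1)}\varphi_x(t,x)\bigr)\,dx\,dt=-\int_{\mathcal T_\tau}u(t)\varphi(t,0)\,dt,$$ and, for all $v_i\in V_I$ and $(k)\in E^+(i)$, $$\int_{\mathcal T_\tau}\int_\Omega z^{(k)}(t,x)\bigl(\varphi_t(t,x)+\lambda^{(k)}\varphi_x(t,x)\bigr)\,dx\,dt=-\alpha_{i,k}\lambda^{(i)}\int_{\mathcal T_\tau}z^{(i)}(t,\omega)\varphi(t,0)\,dt.$$ (For $\tau=0$ all integrals are over the empty set and the condition is vacuous.) *)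

theory Defs
  imports "Graph_Theory.Digraph_Component" "HOL-Analysis.Analysis"
begin

section \<open>Directed tree networks\<close>

text \<open>
  The vertex \<open>v\<^sub>i\<close> is the natural number \<open>i\<close>, and the edge \<open>(k)\<close> is the unique arc
  whose head is \<open>k\<close>. Hence ``\<open>(k)\<close> starts at \<open>v\<^sub>i\<close>'' reads \<open>(i, k) \<in> out_arcs G i\<close>.
\<close>

definition demand_vertices :: "nat pair_pre_digraph \<Rightarrow> nat set" where
  "demand_vertices G = {i \<in> pverts G. out_arcs (with_proj G) i = {}}"

definition inner_vertices :: "nat pair_pre_digraph \<Rightarrow> nat set" where
  "inner_vertices G = pverts G - (demand_vertices G \<union> {0})"

text \<open>
  The library's predicate \<open>tree\<close> only excludes directed cycles. A cycle of the underlying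
  undirected graph is a cycle of length at least 3 of its symmetric digraph: shorter ones
  traverse a single undirected edge back and forth (loops are excluded separately, and
  antiparallel arcs by the number of arcs).
\<close>

definition undirected_tree :: "'a pair_pre_digraph \<Rightarrow> bool" where
  "undirected_tree G \<longleftrightarrow>
     Digraph_Component.connected (with_proj G) \<and>
     \<not> (\<exists>p. pre_digraph.cycle (with_proj (mk_symmetric (with_proj G))) p \<and> 3 \<le> length p)"

locale tree_network = pair_digraph G
  for G :: "nat pair_pre_digraph" +
  fixes n :: nat
    and lam :: "nat \<Rightarrow> real"
    and al :: "nat \<Rightarrow> nat \<Rightarrow> real"
  assumes vertices: "pverts G = {0..n}"
    and number_of_edges: "card (parcs G) = n"
    and tree: "undirected_tree G"
    and unique_source: "{i \<in> pverts G. in_arcs (with_proj G) i = {}} = {0}"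
    and source_edge: "out_arcs (with_proj G) 0 = {(0, 1)}"
    and unique_in_edge: "\<And>i. i \<in> {1..n} \<Longrightarrow> in_degree (with_proj G) i = 1"
    and velocity_pos: "\<And>i. i \<in> {1..n} \<Longrightarrow> 0 < lam i"
    and distribution_pos:
      "\<And>i k. i \<in> inner_vertices G \<Longrightarrow> (i, k) \<in> out_arcs (with_proj G) i \<Longrightarrow> 0 < al i k"
    and distribution_sum:
      "\<And>i. i \<in> inner_vertices G \<Longrightarrow> (\<Sum>k | (i, k) \<in> out_arcs (with_proj G) i. al i k) = 1"


section \<open>Function spaces\<close>

text \<open>
  Elements of \<open>L\<^sup>2(0,T)\<close> are given by representatives. A function with values in \<open>\<real>\<^sup>n\<close> is given
  by its components, indexed by \<open>{1..n}\<close>; components outside this range are never looked at.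
\<close>

definition L2 :: "real \<Rightarrow> (real \<Rightarrow> real) set" where
  "L2 T = {f. f \<in> borel_measurable (lebesgue_on {0<..<T}) \<and>
              integrable (lebesgue_on {0<..<T}) (\<lambda>t. (f t)\<^sup>2)}"

definition L2_norm :: "real \<Rightarrow> (real \<Rightarrow> real) \<Rightarrow> real" where
  "L2_norm T f = sqrt (LINT t|lebesgue_on {0<..<T}. (f t)\<^sup>2)"

definition L2_vec :: "nat \<Rightarrow> real \<Rightarrow> (nat \<Rightarrow> real \<Rightarrow> real) set" where
  "L2_vec n T = {f. \<forall>k\<in>{1..n}. f k \<in> L2 T}"

definition L2_vec_norm :: "nat \<Rightarrow> real \<Rightarrow> (nat \<Rightarrow> real \<Rightarrow> real) \<Rightarrow> real" where
  "L2_vec_norm n T f = sqrt (LINT t|lebesgue_on {0<..<T}. (\<Sum>k=1..n. (f k t)\<^sup>2))"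

text \<open>Here \<open>z k t x\<close> is the component \<open>z\<^sup>(\<^sup>k\<^sup>)(t,x)\<close>.\<close>

definition C_L2 :: "nat \<Rightarrow> real \<Rightarrow> real \<Rightarrow> (nat \<Rightarrow> real \<Rightarrow> real \<Rightarrow> real) set" where
  "C_L2 n T \<omega> = {z.
     (\<forall>x\<in>{0..\<omega>}. (\<lambda>k t. z k t x) \<in> L2_vec n T) \<and>
     (\<forall>x\<^sub>0\<in>{0..\<omega>}.
        ((\<lambda>x. L2_vec_norm n T (\<lambda>k t. z k t x - z k t x\<^sub>0)) \<longlongrightarrow> 0) (at x\<^sub>0 within {0..\<omega>}))}"

text \<open>On \<open>C_L2\<close> the supremum is a maximum, by compactness of \<open>{0..\<omega>}\<close>.\<close>

definition C_L2_norm ::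
    "nat \<Rightarrow> real \<Rightarrow> real \<Rightarrow> (nat \<Rightarrow> real \<Rightarrow> real \<Rightarrow> real) \<Rightarrow> real" where
  "C_L2_norm n T \<omega> z = (SUP x\<in>{0..\<omega>}. L2_vec_norm n T (\<lambda>k t. z k t x))"

text \<open>Equality as elements of \<open>C(\<Omega>,L\<^sup>2)\<close>, for representatives.\<close>

definition C_L2_eq ::
    "nat \<Rightarrow> real \<Rightarrow> real \<Rightarrow> (nat \<Rightarrow> real \<Rightarrow> real \<Rightarrow> real) \<Rightarrow> (nat \<Rightarrow> real \<Rightarrow> real \<Rightarrow> real) \<Rightarrow> bool" where
  "C_L2_eq n T \<omega> z w \<longleftrightarrow>
     (\<forall>x\<in>{0..\<omega>}. \<forall>k\<in>{1..n}. AE t in lebesgue_on {0<..<T}. z k t x = w k t x)"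


section \<open>Weak solutions\<close>

definition dt :: "(real \<times> real \<Rightarrow> real) \<Rightarrow> real \<Rightarrow> real \<Rightarrow> real" where
  "dt \<phi> t x = deriv (\<lambda>s. \<phi> (s, x)) t"

definition dx :: "(real \<times> real \<Rightarrow> real) \<Rightarrow> real \<Rightarrow> real \<Rightarrow> real" where
  "dx \<phi> t x = deriv (\<lambda>y. \<phi> (t, y)) x"

text \<open>
  \<open>C\<^sup>1\<close> on the closure of an open set \<open>U\<close>: continuously differentiable on \<open>U\<close>, where the
  function and its partial derivatives \<open>p\<close>, \<open>q\<close> extend continuously to the closure.
\<close>

definition C1_closure :: "(real \<times> real) set \<Rightarrow> (real \<times> real \<Rightarrow> real) set" where
  "C1_closure U = {\<phi>. continuous_on (closure U) \<phi> \<and>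
     (\<exists>p q. continuous_on (closure U) p \<and> continuous_on (closure U) q \<and>
        (\<forall>y\<in>U. (\<phi> has_derivative (\<lambda>h. p y * fst h + q y * snd h)) (at y)))}"

definition test_functions :: "real \<Rightarrow> real \<Rightarrow> (real \<times> real \<Rightarrow> real) set" where
  "test_functions \<omega> \<tau> = {\<phi> \<in> C1_closure ({0<..<\<tau>} \<times> {0<..<\<omega>}).
     (\<forall>t\<in>closure {0<..<\<tau>}. \<phi> (t, \<omega>) = 0) \<and> (\<forall>x\<in>{0..\<omega>}. \<phi> (\<tau>, x) = 0)}"

text \<open>
  A representative \<open>z\<close> in \<open>C_L2\<close> need not be jointly measurable, so \<open>z k t\<close> may be
  non-measurable in \<open>x\<close> for every \<open>t\<close>. The double integrals over an element of
  \<open>C(\<Omega>,L\<^sup>2)\<close> are those of a jointly measurable version \<open>w\<close>; such a version exists for every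
  element of the space, and by Fubini the integrals do not depend on its choice. The trace
  at \<open>x = \<omega>\<close> is that of \<open>z\<close> itself, since single values of \<open>x\<close> are meaningful.
\<close>

definition jointly_measurable_version ::
    "nat \<Rightarrow> real \<Rightarrow> real \<Rightarrow> (nat \<Rightarrow> real \<Rightarrow> real \<Rightarrow> real) \<Rightarrow> (nat \<Rightarrow> real \<Rightarrow> real \<Rightarrow> real) \<Rightarrow> bool" where
  "jointly_measurable_version n T \<omega> z w \<longleftrightarrow>
     (\<forall>k\<in>{1..n}. (\<lambda>(t, x). w k t x) \<in> borel_measurable borel) \<and> C_L2_eq n T \<omega> z w"

definition weak_solution ::
    "nat pair_pre_digraph \<Rightarrow> nat \<Rightarrow> (nat \<Rightarrow> real) \<Rightarrow> (nat \<Rightarrow> nat \<Rightarrow> real) \<Rightarrow> real \<Rightarrow> real \<Rightarrow>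
     (real \<Rightarrow> real) \<Rightarrow> (nat \<Rightarrow> real \<Rightarrow> real \<Rightarrow> real) \<Rightarrow> bool" where
  "weak_solution G n lam al T \<omega> u z \<longleftrightarrow>
     z \<in> C_L2 n T \<omega> \<and>
     (\<exists>w. jointly_measurable_version n T \<omega> z w \<and>
       (\<forall>\<tau>\<in>{0..T}. \<forall>\<phi>\<in>test_functions \<omega> \<tau>.
          (LINT t|lebesgue_on {0<..<\<tau>}. LINT x|lebesgue_on {0<..<\<omega>}.
              w 1 t x * (dt \<phi> t x + lam 1 * dx \<phi> t x))
            = - (LINT t|lebesgue_on {0<..<\<tau>}. u t * \<phi> (t, 0)) \<and>
          (\<forall>i\<in>inner_vertices G. \<forall>k. (i, k) \<in> out_arcs (with_proj G) i \<longrightarrow>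
             (LINT t|lebesgue_on {0<..<\<tau>}. LINT x|lebesgue_on {0<..<\<omega>}.
                 w k t x * (dt \<phi> t x + lam k * dx \<phi> t x))
               = - (al i k * lam i * (LINT t|lebesgue_on {0<..<\<tau>}. z i t \<omega> * \<phi> (t, 0))))))"


section \<open>The solution formula\<close>

definition solution_formula ::
    "nat pair_pre_digraph \<Rightarrow> (nat \<Rightarrow> real) \<Rightarrow> (nat \<Rightarrow> nat \<Rightarrow> real) \<Rightarrow> real \<Rightarrow> real \<Rightarrow>
     (real \<Rightarrow> real) \<Rightarrow> (nat \<Rightarrow> real \<Rightarrow> real \<Rightarrow> real) \<Rightarrow> bool" where
  "solution_formula G lam al T \<omega> u z \<longleftrightarrow>
     (\<forall>x\<in>{0..\<omega>}. AE t in lebesgue_on {0<..<T}.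
        z 1 t x = (if t - x / lam 1 > 0 then 1 / lam 1 * u (t - x / lam 1) else 0)) \<and>
     (\<forall>i\<in>inner_vertices G. \<forall>k. (i, k) \<in> out_arcs (with_proj G) i \<longrightarrow>
        (\<forall>x\<in>{0..\<omega>}. AE t in lebesgue_on {0<..<T}.
           z k t x = (if t - x / lam k > 0
                      then al i k * (lam i / lam k) * z i (t - x / lam k) \<omega> else 0)))"

end

theory Submission
  imports Defs
begin

text \<open>
  On each edge the equation transports its inflow with constant speed, so unrolling the recursion
  gives \<open>z k t x = c k * u (t - d k - x / lam k)\<close> with constants independent of \<open>u\<close>, where \<open>u\<close> is
  extended by zero. Both the norm bound and membership in \<open>C([0,\<omega>], L\<^sup>2(0,T))\<close> follow, the latter
  from the continuity of translations in \<open>L\<^sup>2\<close>; the weak formulation holds by Fubini's theorem and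
  the fundamental theorem of calculus along characteristics.

  For uniqueness, the difference \<open>v\<close> of two weak solutions on one edge, with equal inflow, is tested with
  \<open>A (c - t + x / lam) * (max 0 (x1 - x))\<^sup>2\<close>. The first factor is constant along characteristics, so
  \<open>W x = (\<integral>t. v t x * A (c - t + x / lam))\<close> satisfies \<open>(\<integral>x=0..x1. (x1 - x) * W x) = 0\<close> for all
  admissible \<open>x1\<close>. Differentiating twice gives \<open>W = 0\<close>. As \<open>A\<close> tends to the indicator of the
  positive half-line, the integral of \<open>v t x\<close> over \<open>t < r\<close> vanishes for every \<open>r\<close>. An induction
  along the tree then treats all edges.
\<close>


section \<open>Induction and recursion along the tree\<close>

context tree_network
begin

text \<open>The choice of test functions is the main obstacle to uniqueness. They must be C1 and
  vanish at \<open>x = \<omega>\<close> and at the final time, so indicators are excluded in both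
  variables; both cut-offs are built from \<open>(max 0 y)\<^sup>2\<close> instead. Vanishing at
  time \<open>T\<close> forces \<open>c + x1 / lam \<le> T\<close>. This is just enough: for the
  value at \<open>x\<close> one takes \<open>c = r - x / lam\<close> with \<open>r \<le> T\<close>,
  and then every \<open>x1 \<le> x\<close> is admissible.

  Measurability shapes the rest. A weak solution is a family of classes in \<open>t\<close>, one for
  each \<open>x\<close>; its double integrals use a jointly measurable version, its traces the
  family itself. Uniqueness is argued in L1, where products with bounded kernels are integrable and
  Fubini applies; on a bounded time interval, L2-continuity in \<open>x\<close> gives L1-continuity.
  The inflow is replaced once by a Borel function on the whole line that vanishes outside
  \<open>{0<..<T}\<close>, so that delays become plain translations and the case distinction of the
  formula disappears. A child edge sees its parent only through the trace at
  \<open>\<omega>\<close>, so equality of the traces a.e. in time carries the induction.\<close>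

lemma parcs_bounds:
  assumes "(i, k) \<in> parcs G"
  shows "i \<le> n" "k \<in> {1..n}"
proof -
  have v: "i \<in> pverts G" "k \<in> pverts G"
    using in_arcsD1[OF assms] in_arcsD2[OF assms] .
  have "0 \<in> {i \<in> pverts G. in_arcs (with_proj G) i = {}}"
    unfolding unique_source by simp
  then have "k \<noteq> 0"
    using assms by (auto simp: in_arcs_def)
  with v vertices show "i \<le> n" "k \<in> {1..n}" by auto
qed

lemma parent_unique:
  assumes "(i, k) \<in> parcs G" "(j, k) \<in> parcs G"
  shows "i = j"
proof -
  have "card (in_arcs (with_proj G) k) = 1"
    using unique_in_edge[of k] parcs_bounds[OF assms(1)] by (simp add: in_degree_def)
  then obtain e where "in_arcs (with_proj G) k = {e}"
    by (auto simp: card_1_singleton_iff)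
  moreover have "(i, k) \<in> in_arcs (with_proj G) k" "(j, k) \<in> in_arcs (with_proj G) k"
    using assms by (auto simp: in_arcs_def)
  ultimately show ?thesis by auto
qed

lemma parent_exists:
  assumes "k \<in> {1..n}"
  obtains i where "(i, k) \<in> parcs G"
proof -
  have "card (in_arcs (with_proj G) k) = 1"
    using unique_in_edge[of k] assms by (simp add: in_degree_def)
  then obtain e where "in_arcs (with_proj G) k = {e}"
    by (auto simp: card_1_singleton_iff)
  then have "e \<in> in_arcs (with_proj G) k" by auto
  then show ?thesis using that by (cases e) (auto simp: in_arcs_def)
qed

lemma source_arc_iff: "(0, k) \<in> parcs G \<longleftrightarrow> k = 1"
proof -
  have "(0, k) \<in> parcs G \<longleftrightarrow> (0, k) \<in> out_arcs (with_proj G) 0"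
    by (auto simp: out_arcs_def)
  then show ?thesis by (simp add: source_edge)
qed

lemma n_pos: "1 \<le> n"
  using parcs_bounds(2)[of 0 1] source_arc_iff by auto

text \<open>A vertex with an outgoing arc is not a demand vertex, so every tail other than the
  source is inner. This reduces the side conditions of the model to plain arcs.\<close>

lemma inner_arc_iff:
  "i \<in> inner_vertices G \<and> (i, k) \<in> out_arcs (with_proj G) i \<longleftrightarrow> (i, k) \<in> parcs G \<and> i \<noteq> 0"
  using in_arcsD1[of i k] by (auto simp: inner_vertices_def demand_vertices_def out_arcs_def)

text \<open>In-degree one alone would allow a directed cycle away from the source; connectivity
  rules it out. The source is accessible since it has no predecessor. Accessibility passes forward
  along an arc, because its tail is the only predecessor of its head, and backward because the
  accessible part is closed under predecessors. Hence it spreads along undirected paths from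
  \<open>0\<close> to all vertices.\<close>

lemma wf_parcs: "wf (parcs G)"
proof -
  let ?A = "Wellfounded.acc (parcs G)"
  have "0 \<in> ?A"
    by (rule accI) (use parcs_bounds(2)[of _ 0] in auto)
  have step: "b \<in> ?A" if a: "a \<in> ?A" and ab: "(a, b) \<in> parcs (mk_symmetric (with_proj G))" for a b
  proof -
    consider "(a, b) \<in> parcs G" | "(b, a) \<in> parcs G"
      using ab by (auto simp: parcs_mk_symmetric)
    then show ?thesis
    proof cases
      case 1
      show ?thesis
        by (rule accI) (use a parent_unique[OF _ 1] in simp)
    next
      case 2
      then show ?thesis using acc_downward[OF a] by simp
    qed
  qed
  have "k \<in> ?A" if "k \<in> pverts G" for k
  proof -
    have "strongly_connected (with_proj (mk_symmetric (with_proj G)))"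
      using tree by (simp add: undirected_tree_def Digraph_Component.connected_def)
    then have "0 \<rightarrow>\<^sup>*\<^bsub>with_proj (mk_symmetric (with_proj G))\<^esub> k"
      using that vertices unfolding strongly_connected_def by auto
    then have "(0, k) \<in> rtrancl_on (pverts G) (parcs (mk_symmetric (with_proj G)))"
      by (simp add: reachable_def)
    then show ?thesis
      by (induction rule: rtrancl_on_induct) (use \<open>0 \<in> ?A\<close> step in auto)
  qed
  moreover have "k \<in> ?A" if "k \<notin> pverts G" for k
    by (rule accI) (use that in_arcsD2[of _ k] in simp)
  ultimately show ?thesis unfolding wf_iff_acc by metis
qed

text \<open>The arc into \<open>k\<close> starts either at the source, which forces
  \<open>k = 1\<close>, or at an inner vertex that is smaller in the well-founded order.\<close>

lemma tree_induct [consumes 1, case_names root child]: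
  assumes "k \<in> {1..n}"
    and "P 1"
    and "\<And>i k. i \<in> inner_vertices G \<Longrightarrow> (i, k) \<in> out_arcs (with_proj G) i \<Longrightarrow>
      i \<in> {1..n} \<Longrightarrow> k \<in> {1..n} \<Longrightarrow> P i \<Longrightarrow> P k"
  shows "P k"
  using assms(1)
proof (induction k rule: wf_induct_rule[OF wf_parcs])
  case (1 k)
  obtain i where i: "(i, k) \<in> parcs G" using parent_exists 1 by blast
  show ?case
  proof (cases "i = 0")
    case True
    then show ?thesis using i source_arc_iff assms(2) by simp
  next
    case False
    then show ?thesis
      using i parcs_bounds[OF i] inner_arc_iff[of i k] 1 assms(3)[of i k] by auto
  qed
qed

text \<open>Supplies the scaling and the delay of each edge, as pairs defined from the parent's
  pair.\<close>

lemma tree_recursion: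
  obtains F :: "nat \<Rightarrow> 'b"
  where "F 1 = a"
    and "\<forall>i k. i \<in> inner_vertices G \<longrightarrow> (i, k) \<in> out_arcs (with_proj G) i \<longrightarrow> F k = s i k (F i)"
proof -
  define pa where "pa k = (THE i. (i, k) \<in> parcs G)" for k
  have pa: "pa k = i" if "(i, k) \<in> parcs G" for i k
    unfolding pa_def using that parent_unique by (intro the_equality) auto
  \<comment> \<open>The body reads \<open>F\<close> only at \<open>pa k\<close>, which is an arc
    predecessor for \<open>k\<close> in \<open>{1..n}\<close>, so the restriction made by
    \<open>wfrec\<close> is harmless there. Parent \<open>0\<close> marks the root edge.\<close>
  define F where
    "F = wfrec (parcs G) (\<lambda>F k. if pa k = 0 then a else s (pa k) k (F (pa k)))"
  have eq: "F k = (if pa k = 0 then a else s (pa k) k (F (pa k)))" if k: "k \<in> {1..n}" for k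
  proof -
    obtain i where "(i, k) \<in> parcs G" using parent_exists[OF k] by blast
    then have "(pa k, k) \<in> parcs G" using pa by simp
    then show ?thesis
      unfolding F_def by (subst wfrec[OF wf_parcs]) (simp add: cut_apply)
  qed
  have arc1: "(0, 1) \<in> parcs G" by (simp add: source_arc_iff)
  show ?thesis
  proof (rule that[of F])
    show "F 1 = a" using eq[of 1] pa[OF arc1] n_pos by simp
    show "\<forall>i k. i \<in> inner_vertices G \<longrightarrow> (i, k) \<in> out_arcs (with_proj G) i \<longrightarrow> F k = s i k (F i)"
    proof (intro allI impI)
      fix i k assume "i \<in> inner_vertices G" "(i, k) \<in> out_arcs (with_proj G) i"
      then have "(i, k) \<in> parcs G" "i \<noteq> 0" using inner_arc_iff by blast+
      then show "F k = s i k (F i)" using eq[of k] pa parcs_bounds by simp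
    qed
  qed
qed

end


section \<open>Continuity of translations in the square-integrable functions\<close>

lemma diff_squared_le: "(a - b)\<^sup>2 \<le> 2 * a\<^sup>2 + 2 * (b::real)\<^sup>2"
proof -
  have "0 \<le> (a + b)\<^sup>2" by simp
  then show ?thesis by (simp add: power2_eq_square algebra_simps)
qed

lemma sum3_squared_le: "(a + b + c)\<^sup>2 \<le> 3 * (a\<^sup>2 + b\<^sup>2 + (c::real)\<^sup>2)"
proof -
  have "0 \<le> (a - b)\<^sup>2 + (b - c)\<^sup>2 + (a - c)\<^sup>2" by simp
  then show ?thesis by (simp add: power2_eq_square algebra_simps)
qed

lemma tendsto_clamp:
  fixes f :: "'a \<Rightarrow> real"
  assumes "(f \<longlongrightarrow> l) F"
  shows "((\<lambda>n. max (- K) (min K (f n))) \<longlongrightarrow> max (- K) (min K l)) F"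
  by (intro tendsto_max tendsto_min tendsto_const assms)

lemma integrable_indicator_Icc [simp]: "integrable lborel (indicator {a..b :: real} :: real \<Rightarrow> real)"
  by (intro integrable_real_indicator) (auto simp: emeasure_lborel_Icc_eq)

lemma integrable_bounded_support:
  fixes f :: "real \<Rightarrow> real"
  assumes "f \<in> borel_measurable borel"
    and "\<And>t. \<bar>f t\<bar> \<le> B * indicator {a..b} t"
  shows "integrable lborel f"
proof (rule Bochner_Integration.integrable_bound)
  show "integrable lborel (\<lambda>t. B * indicator {a..b} t)" by simp
  show "f \<in> borel_measurable lborel" using assms(1) by simp
  show "AE t in lborel. norm (f t) \<le> norm (B * indicator {a..b} t)"
    using order_trans[OF assms(2) abs_ge_self] by simp
qed

text \<open>Density of continuous functions with compact support. Truncating \<open>g\<close> in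
  range and domain costs little by dominated convergence; the truncation is then approximated
  through continuous functions that converge to \<open>g\<close> a.e. Each error is below
  \<open>e / 4\<close> and enters with weight 2, which gives \<open>e\<close>.\<close>

lemma L2_continuous_approximation:
  fixes g :: "real \<Rightarrow> real"
  assumes g [measurable]: "g \<in> borel_measurable borel"
    and int: "integrable lborel (\<lambda>t. (g t)\<^sup>2)" and "0 < e"
  obtains h B R where "continuous_on UNIV h" "\<forall>t. \<bar>h t\<bar> \<le> B * indicator {-R..R} t"
    "integrable lborel (\<lambda>t. (g t - h t)\<^sup>2)" "(\<integral>t. (g t - h t)\<^sup>2 \<partial>lborel) < e"
proof -
  \<comment> \<open>\<open>\<psi> K\<close> is a continuous cut-off, equal to 1 on
    \<open>{-K..K}\<close> and to 0 outside \<open>{-(K+1)..K+1}\<close>; \<open>c K\<close> clamps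
    values to \<open>{-K..K}\<close>.\<close>
  define \<psi> where "\<psi> K t = max 0 (min 1 (real K + 1 - \<bar>t\<bar>))" for K :: nat and t :: real
  define c where "c K y = max (- real K) (min (real K) y)" for K :: nat and y :: real
  have \<psi>: "0 \<le> \<psi> K t" "\<psi> K t \<le> 1" for K t by (auto simp: \<psi>_def)
  have [measurable]: "\<psi> K \<in> borel_measurable borel" "c K \<in> borel_measurable borel" for K
    unfolding \<psi>_def c_def by measurable
  have cont: "continuous_on UNIV (\<psi> K)" "continuous_on UNIV (c K)" for K
    unfolding \<psi>_def c_def by (intro continuous_intros)+
  have bound: "\<bar>c K y * \<psi> K t\<bar> \<le> real K * indicator {- (real K + 1)..real K + 1} t" for K y t
  proof (cases "t \<in> {- (real K + 1)..real K + 1}")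
    case True
    have "\<bar>c K y\<bar> \<le> real K" by (auto simp: c_def)
    then have "\<bar>c K y\<bar> * \<bar>\<psi> K t\<bar> \<le> real K * 1"
      using \<psi> by (intro mult_mono) auto
    then show ?thesis using True by (simp add: abs_mult)
  next
    case False
    then have "\<psi> K t = 0" by (auto simp: \<psi>_def)
    then show ?thesis using False by simp
  qed
  \<comment> \<open>Clamping and damping move \<open>y\<close> towards 0 without crossing it, so
    \<open>y\<^sup>2\<close> dominates the error for every \<open>K\<close>.\<close>
  have close: "(y - c K y * \<psi> K t)\<^sup>2 \<le> y\<^sup>2" for K y t
  proof (cases "0 \<le> y")
    case True
    then have "0 \<le> c K y" "c K y \<le> y" by (auto simp: c_def)
    then have "0 \<le> c K y * \<psi> K t" "c K y * \<psi> K t \<le> y"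
      using \<psi> mult_left_le[OF \<psi>(2), of "c K y" K t] by auto
    then show ?thesis using True by (intro power_mono) auto
  next
    case False
    then have "c K y \<le> 0" "y \<le> c K y" by (auto simp: c_def)
    then have "0 \<le> (- c K y) * \<psi> K t" "(- c K y) * \<psi> K t \<le> (- y) * 1"
      using \<psi> False by (intro mult_nonneg_nonneg mult_mono; simp)+
    then have "(- y - (- c K y) * \<psi> K t)\<^sup>2 \<le> (- y)\<^sup>2" using False by (intro power_mono) auto
    then show ?thesis by (simp add: power2_commute)
  qed
  have "(\<lambda>K. \<integral>t. (g t - c K (g t) * \<psi> K t)\<^sup>2 \<partial>lborel) \<longlonglongrightarrow> (\<integral>t. 0 \<partial>(lborel :: real measure))"
  proof (rule integral_dominated_convergence[where w = "\<lambda>t. (g t)\<^sup>2"])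
    show "AE t in lborel. (\<lambda>K. (g t - c K (g t) * \<psi> K t)\<^sup>2) \<longlonglongrightarrow> 0"
    proof (rule AE_I2)
      fix t
      obtain N :: nat where N: "\<bar>g t\<bar> + \<bar>t\<bar> \<le> real N" using real_arch_simple by blast
      have "(g t - c K (g t) * \<psi> K t)\<^sup>2 = 0" if "N \<le> K" for K
      proof -
        have "real N \<le> real K" using that by simp
        then have "c K (g t) = g t" "\<psi> K t = 1" using N by (auto simp: c_def \<psi>_def)
        then show ?thesis by simp
      qed
      then show "(\<lambda>K. (g t - c K (g t) * \<psi> K t)\<^sup>2) \<longlonglongrightarrow> 0"
        by (intro tendsto_eventually) (auto simp: eventually_sequentially)
    qed
  qed (use int close in auto)
  then have "(\<lambda>K. \<integral>t. (g t - c K (g t) * \<psi> K t)\<^sup>2 \<partial>lborel) \<longlonglongrightarrow> 0" by simp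
  then have "eventually (\<lambda>K. (\<integral>t. (g t - c K (g t) * \<psi> K t)\<^sup>2 \<partial>lborel) < e / 4) sequentially"
    using \<open>0 < e\<close> by (intro order_tendstoD) auto
  then obtain K where K: "(\<integral>t. (g t - c K (g t) * \<psi> K t)\<^sup>2 \<partial>lborel) < e / 4"
    by (auto simp: eventually_sequentially)
  have intK: "integrable lborel (\<lambda>t. (g t - c K (g t) * \<psi> K t)\<^sup>2)"
    by (rule Bochner_Integration.integrable_bound[OF int]) (use close in auto)
  \<comment> \<open>By definition, \<open>measurable_on\<close> yields continuous functions
    converging to \<open>g\<close> off a negligible set. Applying the clamp and the cut-off to them
    keeps continuity and adds a common integrable bound.\<close>
  have "g measurable_on UNIV"
    using g by (intro lebesgue_measurable_imp_measurable_on_real) (auto intro: measurable_completion)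
  then obtain N gs where N: "negligible N" and gs: "\<And>n. continuous_on UNIV (gs n)"
    and lim: "\<And>t. t \<notin> N \<Longrightarrow> (\<lambda>n. gs n t) \<longlonglongrightarrow> g t"
    unfolding measurable_on_def by auto
  have [measurable]: "gs n \<in> borel_measurable borel" for n
    using gs by (simp add: borel_measurable_continuous_onI)
  let ?d = "\<lambda>n t. (c K (g t) * \<psi> K t - c K (gs n t) * \<psi> K t)\<^sup>2"
  have d_bound: "?d n t \<le> (2 * real K)\<^sup>2 * indicator {- (real K + 1)..real K + 1} t" for n t
  proof -
    have "\<bar>c K (g t) * \<psi> K t - c K (gs n t) * \<psi> K t\<bar>
        \<le> 2 * real K * indicator {- (real K + 1)..real K + 1} t"
      using bound[of K "g t" t] bound[of K "gs n t" t] by linarith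
    then have "?d n t \<le> (2 * real K * indicator {- (real K + 1)..real K + 1} t)\<^sup>2"
      by (metis abs_ge_zero power2_abs power_mono)
    then show ?thesis by (auto simp: indicator_def split: if_splits)
  qed
  have "(\<lambda>n. \<integral>t. ?d n t \<partial>lborel) \<longlonglongrightarrow> (\<integral>t. 0 \<partial>(lborel :: real measure))"
  proof (rule integral_dominated_convergence[where
        w = "\<lambda>t. (2 * real K)\<^sup>2 * indicator {- (real K + 1)..real K + 1} t"])
    have "(\<lambda>n. ?d n t) \<longlonglongrightarrow> 0" if "t \<notin> N" for t
    proof -
      have "(\<lambda>n. ?d n t) \<longlonglongrightarrow> (c K (g t) * \<psi> K t - c K (g t) * \<psi> K t)\<^sup>2"
        using tendsto_clamp[OF lim[OF that], of "real K"]
        by (intro tendsto_intros) (simp add: c_def)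
      then show ?thesis by simp
    qed
    moreover have "AE t in lebesgue. t \<notin> N"
      using N by (simp add: AE_not_in negligible_iff_null_sets)
    ultimately have "AE t in lebesgue. (\<lambda>n. ?d n t) \<longlonglongrightarrow> 0" by (auto elim: eventually_mono)
    then show "AE t in lborel. (\<lambda>n. ?d n t) \<longlonglongrightarrow> 0"
      by (simp add: AE_completion_iff)
  qed (use d_bound in auto)
  then have "(\<lambda>n. \<integral>t. ?d n t \<partial>lborel) \<longlonglongrightarrow> 0" by simp
  then have "eventually (\<lambda>n. (\<integral>t. ?d n t \<partial>lborel) < e / 4) sequentially"
    using \<open>0 < e\<close> by (intro order_tendstoD) auto
  then obtain n where n: "(\<integral>t. ?d n t \<partial>lborel) < e / 4"
    by (auto simp: eventually_sequentially)
  have intd: "integrable lborel (?d n)"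
    by (rule integrable_bounded_support[OF _ order_trans[OF _ d_bound]]) auto
  define h where "h t = c K (gs n t) * \<psi> K t" for t
  have [measurable]: "h \<in> borel_measurable borel" unfolding h_def by measurable
  have le: "(g t - h t)\<^sup>2 \<le> 2 * (g t - c K (g t) * \<psi> K t)\<^sup>2 + 2 * ?d n t" for t
  proof -
    have "0 \<le> ((g t - c K (g t) * \<psi> K t) - (c K (g t) * \<psi> K t - c K (gs n t) * \<psi> K t))\<^sup>2" by simp
    then show ?thesis unfolding h_def by (simp add: power2_eq_square algebra_simps)
  qed
  have inth: "integrable lborel (\<lambda>t. (g t - h t)\<^sup>2)"
    by (rule Bochner_Integration.integrable_bound
        [where f = "\<lambda>t. 2 * (g t - c K (g t) * \<psi> K t)\<^sup>2 + 2 * ?d n t"])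
      (use intK intd le in auto)
  have "(\<integral>t. (g t - h t)\<^sup>2 \<partial>lborel) \<le> (\<integral>t. 2 * (g t - c K (g t) * \<psi> K t)\<^sup>2 + 2 * ?d n t \<partial>lborel)"
    by (rule integral_mono[OF inth _ le]) (use intK intd in auto)
  also have "\<dots> = 2 * (\<integral>t. (g t - c K (g t) * \<psi> K t)\<^sup>2 \<partial>lborel) + 2 * (\<integral>t. ?d n t \<partial>lborel)"
    using intK intd by simp
  also have "\<dots> < e" using K n by linarith
  finally have lt: "(\<integral>t. (g t - h t)\<^sup>2 \<partial>lborel) < e" .
  have "continuous_on UNIV (\<lambda>t. c K (gs n t))"
    by (rule continuous_on_compose2[OF cont(2) gs]) auto
  then have "continuous_on UNIV h"
    unfolding h_def by (intro continuous_on_mult cont)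
  then show ?thesis
    using that[of h "real K" "real K + 1"] bound inth lt by (simp add: h_def)
qed

lemma L2_translation_continuous:
  fixes g :: "real \<Rightarrow> real"
  assumes g [measurable]: "g \<in> borel_measurable borel"
    and int: "integrable lborel (\<lambda>t. (g t)\<^sup>2)" and X: "X \<longlonglongrightarrow> 0"
  shows "(\<lambda>n. \<integral>t. (g (t - X n) - g t)\<^sup>2 \<partial>lborel) \<longlonglongrightarrow> 0"
proof (rule LIMSEQ_I)
  fix e :: real assume "0 < e"
  \<comment> \<open>Three squared errors below \<open>e / 9\<close>, each weighted by 3 in
    \<open>sum3_squared_le\<close>, stay below \<open>e\<close>. Two of them coincide by translation
    invariance.\<close>
  then have "0 < e / 9" by simp
  then obtain h B R where h: "continuous_on UNIV h"
    and "\<forall>t. \<bar>h t\<bar> \<le> B * indicator {-R..R} t"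
    and ih: "integrable lborel (\<lambda>t. (g t - h t)\<^sup>2)" and lt: "(\<integral>t. (g t - h t)\<^sup>2 \<partial>lborel) < e / 9"
    using L2_continuous_approximation[OF g int] by blast
  then have hB: "\<bar>h t\<bar> \<le> B * indicator {-R..R} t" for t by blast
  have [measurable]: "h \<in> borel_measurable borel"
    using h by (simp add: borel_measurable_continuous_onI)
  \<comment> \<open>A common bound on the shifts confines all translates of \<open>h\<close> to one
    interval, hence a single integrable majorant.\<close>
  obtain C where C: "\<And>n. \<bar>X n\<bar> \<le> C"
    using X Bseq_def convergent_imp_Bseq convergent_def by (metis real_norm_def)
  have hb: "(h (t - X n) - h t)\<^sup>2 \<le> (2 * \<bar>B\<bar>)\<^sup>2 * indicator {- (R + C)..R + C} t" for n t
  proof (cases "t \<in> {- (R + C)..R + C}")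
    case True
    have "\<bar>h s\<bar> \<le> \<bar>B\<bar>" for s
      using hB[of s] by (cases "s \<in> {-R..R}") auto
    then have "\<bar>h (t - X n) - h t\<bar> \<le> 2 * \<bar>B\<bar>"
      by (smt (verit))
    then have "(h (t - X n) - h t)\<^sup>2 \<le> (2 * \<bar>B\<bar>)\<^sup>2"
      by (metis abs_ge_zero power2_abs power_mono)
    then show ?thesis using True by simp
  next
    case False
    then have "t \<notin> {-R..R}" "t - X n \<notin> {-R..R}" using C[of n] by auto
    then have "h t = 0" "h (t - X n) = 0" using hB[of t] hB[of "t - X n"] by auto
    then show ?thesis using False by simp
  qed
  have "(\<lambda>n. \<integral>t. (h (t - X n) - h t)\<^sup>2 \<partial>lborel) \<longlonglongrightarrow> (\<integral>t. 0 \<partial>(lborel :: real measure))"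
  proof (rule integral_dominated_convergence[where
        w = "\<lambda>t. (2 * \<bar>B\<bar>)\<^sup>2 * indicator {- (R + C)..R + C} t"])
    show "AE t in lborel. (\<lambda>n. (h (t - X n) - h t)\<^sup>2) \<longlonglongrightarrow> 0"
    proof (rule AE_I2)
      fix t
      have "(\<lambda>n. h (t - X n)) \<longlonglongrightarrow> h t"
        by (rule continuous_on_tendsto_compose[OF h])
          (use tendsto_diff[OF tendsto_const[of t] X] in auto)
      then have "(\<lambda>n. (h (t - X n) - h t)\<^sup>2) \<longlonglongrightarrow> (h t - h t)\<^sup>2"
        by (intro tendsto_intros)
      then show "(\<lambda>n. (h (t - X n) - h t)\<^sup>2) \<longlonglongrightarrow> 0" by simp
    qed
  qed (use hb in auto)
  then have "(\<lambda>n. \<integral>t. (h (t - X n) - h t)\<^sup>2 \<partial>lborel) \<longlonglongrightarrow> 0" by simp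
  then have "eventually (\<lambda>n. (\<integral>t. (h (t - X n) - h t)\<^sup>2 \<partial>lborel) < e / 9) sequentially"
    using \<open>0 < e\<close> by (intro order_tendstoD) auto
  then obtain N where N: "\<And>n. N \<le> n \<Longrightarrow> (\<integral>t. (h (t - X n) - h t)\<^sup>2 \<partial>lborel) < e / 9"
    by (auto simp: eventually_sequentially)
  have "norm ((\<integral>t. (g (t - X n) - g t)\<^sup>2 \<partial>lborel) - 0) < e" if "N \<le> n" for n
  proof -
    have i1: "integrable lborel (\<lambda>t. (g (t - X n) - h (t - X n))\<^sup>2)"
      using lborel_integrable_real_affine[OF ih, of 1 "- X n"] by simp
    have e1: "(\<integral>t. (g (t - X n) - h (t - X n))\<^sup>2 \<partial>lborel) = (\<integral>t. (g t - h t)\<^sup>2 \<partial>lborel)"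
      using lborel_integral_real_affine[of 1 "\<lambda>t. (g t - h t)\<^sup>2" "- X n"] by simp
    have i2: "integrable lborel (\<lambda>t. (h (t - X n) - h t)\<^sup>2)"
      by (rule integrable_bounded_support[OF _ order_trans[OF _ hb]]) auto
    have le: "(g (t - X n) - g t)\<^sup>2 \<le> 3 * ((g (t - X n) - h (t - X n))\<^sup>2
        + (h (t - X n) - h t)\<^sup>2 + (g t - h t)\<^sup>2)" for t
      using sum3_squared_le[of "g (t - X n) - h (t - X n)" "h (t - X n) - h t" "h t - g t"]
      by (simp add: power2_commute[of "h t" "g t"])
    let ?R = "\<lambda>t. 3 * ((g (t - X n) - h (t - X n))\<^sup>2 + (h (t - X n) - h t)\<^sup>2 + (g t - h t)\<^sup>2)"
    have iR: "integrable lborel ?R" using i1 i2 ih by simp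
    have iL: "integrable lborel (\<lambda>t. (g (t - X n) - g t)\<^sup>2)"
      by (rule Bochner_Integration.integrable_bound[OF iR]) (use le in auto)
    have "(\<integral>t. (g (t - X n) - g t)\<^sup>2 \<partial>lborel) \<le> (\<integral>t. ?R t \<partial>lborel)"
      by (rule integral_mono[OF iL iR le])
    also have "\<dots> = 3 * (2 * (\<integral>t. (g t - h t)\<^sup>2 \<partial>lborel) + (\<integral>t. (h (t - X n) - h t)\<^sup>2 \<partial>lborel))"
      using i1 i2 ih e1 by simp
    also have "\<dots> < e"
    proof -
      have "3 * (2 * a + b) < e" if ab: "a < e / 9" "b < e / 9" for a b :: real
      proof -
        have "9 * a < e" "9 * b < e" using ab by (simp_all add: field_simps)
        then show ?thesis by argo
      qed
      then show ?thesis using N[OF that] lt by blast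
    qed
    finally show ?thesis by simp
  qed
  then show "\<exists>N. \<forall>n\<ge>N. norm ((\<integral>t. (g (t - X n) - g t)\<^sup>2 \<partial>lborel) - 0) < e" by blast
qed


section \<open>The transport equation along characteristics\<close>

text \<open>Bridge from the measure used in the definitions to \<open>lborel\<close>, where
  translations and product measures are handled; for Borel functions the completion changes
  nothing.\<close>

lemma lebesgue_on_lborel:
  fixes f :: "real \<Rightarrow> real"
  assumes "f \<in> borel_measurable borel"
  shows "integrable (lebesgue_on {a<..<b}) f \<longleftrightarrow> integrable lborel (\<lambda>t. indicator {a<..<b} t * f t)"
    and "(LINT t|lebesgue_on {a<..<b}. f t) = (\<integral>t. indicator {a<..<b} t * f t \<partial>lborel)"
proof -
  have [measurable]: "(\<lambda>t. indicator {a<..<b} t * f t) \<in> borel_measurable lborel"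
    using assms by measurable
  show "integrable (lebesgue_on {a<..<b}) f \<longleftrightarrow> integrable lborel (\<lambda>t. indicator {a<..<b} t * f t)"
    by (simp add: integrable_restrict_space integrable_completion)
  show "(LINT t|lebesgue_on {a<..<b}. f t) = (\<integral>t. indicator {a<..<b} t * f t \<partial>lborel)"
    by (simp add: integral_restrict_space integral_completion)
qed

text \<open>Nothing is known about \<open>dt\<close> and \<open>dx\<close> outside the open
  rectangle. \<open>P\<close> is a bounded Borel function on the whole plane that can replace
  \<open>dt \<phi> t x + lam * dx \<phi> t x\<close> in every integral, and up to the factor
  \<open>lam\<close> it is the derivative of \<open>\<phi>\<close> along the
  characteristics.\<close>

lemma C1_closure_bounded_derivative:
  assumes phi: "\<phi> \<in> C1_closure ({0<..<\<tau>} \<times> {0<..<\<omega>})" and "0 < \<tau>" "0 < \<omega>" "0 < lam"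
  obtains P M where "P \<in> borel_measurable borel" "\<forall>y. \<bar>P y\<bar> \<le> M"
    "continuous_on ({0..\<tau>} \<times> {0..\<omega>}) \<phi>"
    "\<forall>t\<in>{0<..<\<tau>}. \<forall>x\<in>{0<..<\<omega>}. dt \<phi> t x + lam * dx \<phi> t x = P (t, x)"
    "\<forall>s. \<forall>x\<in>{0<..<\<omega>}. s + x / lam \<in> {0<..<\<tau>} \<longrightarrow>
       ((\<lambda>y. \<phi> (s + y / lam, y)) has_real_derivative P (s + x / lam, x) / lam) (at x)"
proof -
  let ?R = "{0<..<\<tau>} \<times> {0<..<\<omega>}"
  have cl: "closure ?R = {0..\<tau>} \<times> {0..\<omega>}"
    using assms by (simp add: closure_Times)
  obtain p q where c: "continuous_on (closure ?R) p" "continuous_on (closure ?R) q"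
    and d: "\<And>y. y \<in> ?R \<Longrightarrow> (\<phi> has_derivative (\<lambda>h. p y * fst h + q y * snd h)) (at y)"
    using phi unfolding C1_closure_def by blast
  have cphi: "continuous_on ({0..\<tau>} \<times> {0..\<omega>}) \<phi>"
    using phi cl unfolding C1_closure_def by auto
  \<comment> \<open>Cutting off at the closed rectangle gives boundedness by compactness and Borel
    measurability on the plane.\<close>
  define P where "P y = indicator ({0..\<tau>} \<times> {0..\<omega>}) y *\<^sub>R (p y + lam * q y)" for y
  have PQ: "continuous_on ({0..\<tau>} \<times> {0..\<omega>}) (\<lambda>y. p y + lam * q y)"
    using c cl by (intro continuous_intros) auto
  then have cP: "continuous_on ({0..\<tau>} \<times> {0..\<omega>}) P"
    by (rule continuous_on_eq) (simp add: P_def)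
  have "P \<in> borel_measurable borel"
    unfolding P_def
    by (rule borel_measurable_continuous_on_indicator[OF _ PQ]) (auto intro: borel_closed closed_Times)
  moreover obtain M where M: "\<And>y. y \<in> {0..\<tau>} \<times> {0..\<omega>} \<Longrightarrow> norm (P y) \<le> M"
    using compact_imp_bounded[OF compact_continuous_image[OF cP]]
    by (auto simp: bounded_iff compact_Times)
  have "\<bar>P y\<bar> \<le> max M 0" for y
    using M[of y] by (cases "y \<in> {0..\<tau>} \<times> {0..\<omega>}") (auto simp: P_def)
  moreover have "dt \<phi> t x + lam * dx \<phi> t x = P (t, x)"
    if "t \<in> {0<..<\<tau>}" "x \<in> {0<..<\<omega>}" for t x
  proof -
    have D: "(\<phi> has_derivative (\<lambda>h. p (t, x) * fst h + q (t, x) * snd h)) (at (t, x))"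
      using d that by simp
    have "((\<lambda>s. \<phi> (s, x)) has_derivative (\<lambda>h. p (t, x) * fst (h, 0::real) + q (t, x) * snd (h, 0::real))) (at t)"
      by (rule has_derivative_compose[where f = "\<lambda>s. (s, x)" and s = UNIV, OF _ D, simplified])
        (auto intro!: derivative_eq_intros)
    then have "((\<lambda>s. \<phi> (s, x)) has_real_derivative p (t, x)) (at t)"
      by (simp add: has_field_derivative_def)
    moreover have "((\<lambda>y. \<phi> (t, y)) has_derivative (\<lambda>h. p (t, x) * fst (0::real, h) + q (t, x) * snd (0::real, h))) (at x)"
      by (rule has_derivative_compose[where f = "\<lambda>y. (t, y)" and s = UNIV, OF _ D, simplified])
        (auto intro!: derivative_eq_intros)
    then have "((\<lambda>y. \<phi> (t, y)) has_real_derivative q (t, x)) (at x)"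
      by (simp add: has_field_derivative_def)
    ultimately show ?thesis
      using that by (simp add: dt_def dx_def DERIV_imp_deriv P_def)
  qed
  moreover have "((\<lambda>y. \<phi> (s + y / lam, y)) has_real_derivative P (s + x / lam, x) / lam) (at x)"
    if "x \<in> {0<..<\<omega>}" "s + x / lam \<in> {0<..<\<tau>}" for s x
  proof -
    let ?z = "(s + x / lam, x)"
    have D: "(\<phi> has_derivative (\<lambda>h. p ?z * fst h + q ?z * snd h)) (at ?z)"
      using d that by simp
    have "((\<lambda>y. \<phi> (s + y / lam, y)) has_derivative
        (\<lambda>h. p ?z * fst (h / lam, h) + q ?z * snd (h / lam, h))) (at x)"
      by (rule has_derivative_compose[where f = "\<lambda>y. (s + y / lam, y)" and s = UNIV])
        (use D \<open>0 < lam\<close> in \<open>auto intro!: derivative_eq_intros\<close>)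
    moreover have "(\<lambda>h. p ?z * fst (h / lam, h) + q ?z * snd (h / lam, h)) = (*) (P ?z / lam)"
      using that \<open>0 < lam\<close> by (auto simp: P_def field_simps)
    ultimately show ?thesis by (simp add: has_field_derivative_def)
  qed
  ultimately show ?thesis using that[of P "max M 0"] cphi by blast
qed


text \<open>The L1 norm of a translate of \<open>g\<close> does not depend on \<open>x\<close>, so
  the inner integral is at most a constant on a bounded interval. The shift \<open>k\<close> covers
  both sides of the change to characteristic coordinates: \<open>k x = x / lam\<close> before it and
  \<open>k x = 0\<close> after it.\<close>

lemma integrable_pair_shifted:
  fixes g :: "real \<Rightarrow> real"
  assumes g [measurable]: "g \<in> borel_measurable borel" and ig: "integrable lborel g"
    and k [measurable]: "k \<in> borel_measurable borel"
    and Q [measurable]: "case_prod Q \<in> borel_measurable (borel \<Otimes>\<^sub>M borel)"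
    and bound: "\<And>x t. \<bar>Q x t\<bar> \<le> (M :: real)"
  shows "integrable (lborel \<Otimes>\<^sub>M lborel)
    (\<lambda>(x, t). indicator {0<..<\<omega>} (x :: real) * (g (t - k x) * Q x t))"
proof (rule lborel_pair.Fubini_integrable)
  have i: "integrable lborel (\<lambda>t. g (t - k x))" for x
    using lborel_integrable_real_affine[OF ig, of 1 "- k x"] by simp
  have e: "(\<integral>t. \<bar>g (t - k x)\<bar> \<partial>lborel) = (\<integral>t. \<bar>g t\<bar> \<partial>lborel)" for x
    using lborel_integral_real_affine[of 1 "\<lambda>t. \<bar>g t\<bar>" "- k x"] by simp
  have M: "0 \<le> M" using bound[of 0 0] by linarith
  have le: "\<bar>g (t - k x) * Q x t\<bar> \<le> \<bar>g (t - k x)\<bar> * M" for x t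
    using bound[of x t] M by (auto simp: abs_mult intro: mult_left_mono)
  show "(\<lambda>(x, t). indicator {0<..<\<omega>} x * (g (t - k x) * Q x t))
      \<in> borel_measurable (lborel \<Otimes>\<^sub>M lborel)"
    by measurable
  have iQ: "integrable lborel (\<lambda>t. g (t - k x) * Q x t)" for x
    by (rule Bochner_Integration.integrable_bound[where f = "\<lambda>t. \<bar>g (t - k x)\<bar> * M"])
      (use i le M in \<open>auto simp: abs_mult\<close>)
  then show "AE x in lborel. integrable lborel
      (\<lambda>t. case (x, t) of (x, t) \<Rightarrow> indicator {0<..<\<omega>} x * (g (t - k x) * Q x t))"
    by simp
  have "\<bar>\<integral>t. norm (indicator {0<..<\<omega>} x * (g (t - k x) * Q x t)) \<partial>lborel\<bar>
      \<le> ((\<integral>t. \<bar>g t\<bar> \<partial>lborel) * M) * indicator {0..\<omega>} x" for x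
  proof (cases "x \<in> {0<..<\<omega>}")
    case True
    have "(\<integral>t. \<bar>g (t - k x) * Q x t\<bar> \<partial>lborel) \<le> (\<integral>t. \<bar>g (t - k x)\<bar> * M \<partial>lborel)"
      by (rule integral_mono) (use i iQ le in auto)
    then show ?thesis using True by (simp add: e)
  qed (use M in auto)
  then have "integrable lborel (\<lambda>x. \<integral>t. norm (indicator {0<..<\<omega>} x * (g (t - k x) * Q x t)) \<partial>lborel)"
    by (intro integrable_bounded_support) (measurable, blast)
  then show "integrable lborel (\<lambda>x. \<integral>t. norm
      (case (x, t) of (x, t) \<Rightarrow> indicator {0<..<\<omega>} x * (g (t - k x) * Q x t)) \<partial>lborel)"
    by simp
qed

text \<open>In the coordinate \<open>s = t - x / lam\<close> the factor \<open>g s\<close> is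
  constant in \<open>x\<close>, and the remaining integrand is, up to \<open>lam\<close>, the
  derivative of \<open>\<phi>\<close> along one characteristic. Only the entry value
  \<open>\<phi> (s, 0)\<close> survives, since \<open>\<phi>\<close> vanishes where the
  characteristic leaves the rectangle.\<close>

lemma transport_weak_form:
  fixes g :: "real \<Rightarrow> real"
  assumes g [measurable]: "g \<in> borel_measurable borel" and ig: "integrable lborel g"
    and g0: "\<And>s. s \<le> 0 \<Longrightarrow> g s = 0"
    and pos: "0 < lam" "0 < \<omega>" "0 \<le> \<tau>" and phi: "\<phi> \<in> test_functions \<omega> \<tau>"
  shows "(LINT t|lebesgue_on {0<..<\<tau>}. LINT x|lebesgue_on {0<..<\<omega>}.
      g (t - x / lam) * (dt \<phi> t x + lam * dx \<phi> t x))
    = - (lam * (LINT t|lebesgue_on {0<..<\<tau>}. g t * \<phi> (t, 0)))"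
proof (cases "\<tau> = 0")
  case False
  with pos have "0 < \<tau>" by simp
  have C1: "\<phi> \<in> C1_closure ({0<..<\<tau>} \<times> {0<..<\<omega>})"
    and phi0: "\<And>t. t \<in> {0..\<tau>} \<Longrightarrow> \<phi> (t, \<omega>) = 0" "\<And>x. x \<in> {0..\<omega>} \<Longrightarrow> \<phi> (\<tau>, x) = 0"
    using phi \<open>0 < \<tau>\<close> by (auto simp: test_functions_def)
  obtain P M where P: "P \<in> borel_measurable borel" and "\<forall>y. \<bar>P y\<bar> \<le> M"
    and cphi: "continuous_on ({0..\<tau>} \<times> {0..\<omega>}) \<phi>"
    and dP: "\<forall>t\<in>{0<..<\<tau>}. \<forall>x\<in>{0<..<\<omega>}. dt \<phi> t x + lam * dx \<phi> t x = P (t, x)"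
    and char: "\<forall>s. \<forall>x\<in>{0<..<\<omega>}. s + x / lam \<in> {0<..<\<tau>} \<longrightarrow>
       ((\<lambda>y. \<phi> (s + y / lam, y)) has_real_derivative P (s + x / lam, x) / lam) (at x)"
    by (rule C1_closure_bounded_derivative[OF C1 \<open>0 < \<tau>\<close> \<open>0 < \<omega>\<close> \<open>0 < lam\<close>])
  have bP: "\<bar>P y\<bar> \<le> M" for y using \<open>\<forall>y. \<bar>P y\<bar> \<le> M\<close> by blast
  have [measurable]: "P \<in> borel_measurable (borel \<Otimes>\<^sub>M borel)"
    using P by (simp add: borel_prod)
  let ?Q = "\<lambda>x t. indicator {0<..<\<tau>} t * P (t, x)"
  have bQ: "\<bar>?Q x t\<bar> \<le> M" for x t
    using bP[of "(t, x)"] by (auto simp: indicator_def)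
  \<comment> \<open>\<open>?F\<close> and \<open>?G\<close> are the same integrand before and after
    the substitution \<open>t = s + x / lam\<close>; Fubini is applied once to each.\<close>
  let ?F = "\<lambda>x t. indicator {0<..<\<omega>} x * (g (t - x / lam) * ?Q x t)"
  let ?G = "\<lambda>x s. indicator {0<..<\<omega>} x * (g s * ?Q x (s + x / lam))"
  have iF: "integrable (lborel \<Otimes>\<^sub>M lborel) (\<lambda>(x, t). ?F x t)"
    by (rule integrable_pair_shifted[OF g ig _ _ bQ]) measurable
  have iG: "integrable (lborel \<Otimes>\<^sub>M lborel) (\<lambda>(x, s). ?G x s)"
    using integrable_pair_shifted[OF g ig, of "\<lambda>x. 0" "\<lambda>x s. ?Q x (s + x / lam)" M \<omega>] bQ
    by simp
  have "(LINT t|lebesgue_on {0<..<\<tau>}. LINT x|lebesgue_on {0<..<\<omega>}.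
        g (t - x / lam) * (dt \<phi> t x + lam * dx \<phi> t x))
      = (LINT t|lebesgue_on {0<..<\<tau>}. LINT x|lebesgue_on {0<..<\<omega>}. g (t - x / lam) * P (t, x))"
    by (intro Bochner_Integration.integral_cong refl) (use dP in auto)
  also have "\<dots> = (LINT t|lebesgue_on {0<..<\<tau>}. \<integral>x. indicator {0<..<\<omega>} x * (g (t - x / lam) * P (t, x)) \<partial>lborel)"
    by (intro Bochner_Integration.integral_cong refl lebesgue_on_lborel) measurable
  also have "\<dots> = (\<integral>t. indicator {0<..<\<tau>} t * (\<integral>x. indicator {0<..<\<omega>} x * (g (t - x / lam) * P (t, x)) \<partial>lborel) \<partial>lborel)"
    by (intro lebesgue_on_lborel) measurable
  also have "\<dots> = (\<integral>t. (\<integral>x. ?F x t \<partial>lborel) \<partial>lborel)"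
    by (intro Bochner_Integration.integral_cong refl) (auto simp: indicator_def)
  also have "\<dots> = (\<integral>x. (\<integral>t. ?F x t \<partial>lborel) \<partial>lborel)"
    by (rule lborel_pair.Fubini_integral[OF iF])
  also have "\<dots> = (\<integral>x. (\<integral>s. ?G x s \<partial>lborel) \<partial>lborel)"
  proof (rule Bochner_Integration.integral_cong[OF refl])
    fix x :: real
    show "(\<integral>t. ?F x t \<partial>lborel) = (\<integral>s. ?G x s \<partial>lborel)"
      using lborel_integral_real_affine[of 1 "?F x" "x / lam"] by (simp add: add.commute)
  qed
  also have "\<dots> = (\<integral>s. (\<integral>x. ?G x s \<partial>lborel) \<partial>lborel)"
    by (rule lborel_pair.Fubini_integral[OF iG, symmetric])
  \<comment> \<open>The inner indicator makes the factor with \<open>\<phi> (s, 0)\<close> Borel on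
    the whole line, as \<open>\<phi>\<close> is uncontrolled outside the rectangle.\<close>
  also have "\<dots> = (\<integral>s. indicator {0<..<\<tau>} s * (g s * (- lam * (indicator {0..\<tau>} s * \<phi> (s, 0)))) \<partial>lborel)"
  proof (rule Bochner_Integration.integral_cong[OF refl])
    fix s :: real
    \<comment> \<open>\<open>s\<close> is the time at which the characteristic passes
      \<open>x = 0\<close>. For \<open>s \<le> 0\<close> it carries the zero initial value, for
      \<open>\<tau> \<le> s\<close> it misses the rectangle, and otherwise it enters at
      \<open>(s, 0)\<close>.\<close>
    consider "s \<le> 0" | "\<tau> \<le> s" | "0 < s" "s < \<tau>" by linarith
    then show "(\<integral>x. ?G x s \<partial>lborel)
      = indicator {0<..<\<tau>} s * (g s * (- lam * (indicator {0..\<tau>} s * \<phi> (s, 0))))"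
    proof cases
      case 1
      then show ?thesis using g0 by simp
    next
      case 2
      have "?G x s = 0" for x
      proof (cases "x \<in> {0<..<\<omega>}")
        case True
        then have "0 < x / lam" using pos by simp
        then show ?thesis using 2 by simp
      qed simp
      then have "(\<integral>x. ?G x s \<partial>lborel) = (\<integral>x. 0 \<partial>(lborel :: real measure))"
        by (simp only:)
      then show ?thesis using 2 by simp
    next
      case 3
      \<comment> \<open>The position where the characteristic from \<open>(s, 0)\<close> leaves the
        rectangle: through \<open>x = \<omega>\<close> or through \<open>t = \<tau>\<close>,
        whichever comes first.\<close>
      define b where "b = min \<omega> (lam * (\<tau> - s))"
      have b: "0 < b" using pos 3 by (simp add: b_def)
      have path: "(s + x / lam, x) \<in> {0..\<tau>} \<times> {0..\<omega>}" if "x \<in> {0..b}" for x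
      proof -
        have "0 \<le> x / lam" using that pos by simp
        moreover have "x / lam \<le> \<tau> - s" using that pos by (simp add: b_def field_simps)
        ultimately have "0 \<le> s + x / lam" "s + x / lam \<le> \<tau>" using 3 by linarith+
        then show ?thesis using that by (auto simp: b_def)
      qed
      have inner: "x \<in> {0<..<\<omega>}" "s + x / lam \<in> {0<..<\<tau>}" if "x \<in> {0<..<b}" for x
      proof -
        have "0 < x / lam" using that pos by simp
        moreover have "x / lam < \<tau> - s" using that pos by (simp add: b_def field_simps)
        ultimately have "0 < s + x / lam" "s + x / lam < \<tau>" using 3 by linarith+
        then show "x \<in> {0<..<\<omega>}" "s + x / lam \<in> {0<..<\<tau>}"
          using that by (auto simp: b_def)
      qed
      have ind: "?G x s = g s * (indicator {0<..<b} x * P (s + x / lam, x))" for x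
      proof (cases "x \<in> {0<..<b}")
        case True
        then show ?thesis using inner[OF True] by simp
      next
        case False
        then have "x \<notin> {0<..<\<omega>} \<or> lam * (\<tau> - s) \<le> x" by (auto simp: b_def)
        then have "x \<notin> {0<..<\<omega>} \<or> s + x / lam \<notin> {0<..<\<tau>}"
          using pos by (auto simp: field_simps)
        then show ?thesis using False by auto
      qed
      have "((\<lambda>x. P (s + x / lam, x) / lam) has_integral
          \<phi> (s + b / lam, b) - \<phi> (s + 0 / lam, 0)) {0..b}"
      proof (rule fundamental_theorem_of_calculus_interior)
        show "continuous_on {0..b} (\<lambda>y. \<phi> (s + y / lam, y))"
          by (rule continuous_on_compose2[OF cphi]) (use path pos in \<open>auto intro!: continuous_intros\<close>)
        show "((\<lambda>y. \<phi> (s + y / lam, y)) has_vector_derivative P (s + x / lam, x) / lam) (at x)"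
          if "x \<in> {0<..<b}" for x
          using char inner[OF that] by (simp add: has_real_derivative_iff_has_vector_derivative[symmetric])
      qed (use b in simp)
      moreover have "\<phi> (s + b / lam, b) = 0"
      proof (cases "b = \<omega>")
        case True
        then show ?thesis using path[of b] phi0(1)[of "s + b / lam"] b by auto
      next
        case False
        then have "b = lam * (\<tau> - s)" by (auto simp: b_def)
        then have "s + b / lam = \<tau>" using pos by simp
        then show ?thesis using path[of b] phi0(2)[of b] b by auto
      qed
      ultimately have "((\<lambda>x. P (s + x / lam, x) / lam) has_integral - \<phi> (s, 0)) {0..b}"
        by simp
      from has_integral_mult_right[OF this, of lam]
      have hi: "((\<lambda>x. P (s + x / lam, x)) has_integral - lam * \<phi> (s, 0)) {0<..<b}"
        using pos by (simp add: has_integral_Icc_iff_Ioo)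
      have "set_integrable lborel {0<..<b} (\<lambda>x. P (s + x / lam, x))"
        unfolding set_integrable_def
      proof (rule integrable_bounded_support)
        show "\<bar>indicator {0<..<b} x *\<^sub>R P (s + x / lam, x)\<bar> \<le> M * indicator {0..b} x" for x
          using bP[of "(s + x / lam, x)"] order_trans[OF abs_ge_zero bP] by (auto simp: indicator_def)
      qed measurable
      then have "(LINT x:{0<..<b}|lborel. P (s + x / lam, x)) = - lam * \<phi> (s, 0)"
        using set_borel_integral_eq_integral(2) integral_unique[OF hi] by metis
      then have "(\<integral>x. ?G x s \<partial>lborel) = g s * (- lam * \<phi> (s, 0))"
        unfolding ind by (simp add: set_lebesgue_integral_def)
      then show ?thesis using 3 by simp
    qed
  qed
  also have "\<dots> = (LINT s|lebesgue_on {0<..<\<tau>}. g s * (- lam * (indicator {0..\<tau>} s * \<phi> (s, 0))))"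
  proof (rule lebesgue_on_lborel(2)[symmetric])
    have "continuous_on {0..\<tau>} (\<lambda>s. \<phi> (s, 0))"
      by (rule continuous_on_compose2[OF cphi]) (use pos in \<open>auto intro!: continuous_intros\<close>)
    then have "(\<lambda>s. indicator {0..\<tau>} s *\<^sub>R \<phi> (s, 0)) \<in> borel_measurable borel"
      by (intro borel_measurable_continuous_on_indicator) auto
    then show "(\<lambda>s. g s * (- lam * (indicator {0..\<tau>} s * \<phi> (s, 0)))) \<in> borel_measurable borel"
      by simp
  qed
  also have "\<dots> = (LINT s|lebesgue_on {0<..<\<tau>}. (- lam) * (g s * \<phi> (s, 0)))"
    by (intro Bochner_Integration.integral_cong refl) auto
  also have "\<dots> = - (lam * (LINT t|lebesgue_on {0<..<\<tau>}. g t * \<phi> (t, 0)))"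
    by simp
  finally show ?thesis .
qed simp


section \<open>Uniqueness of weak solutions on one edge\<close>

text \<open>The positive and the negative part of \<open>f\<close> are densities of two measures
  that are finite and equal on all half-lines \<open>{r<..}\<close>. Half-lines determine the
  measure, so the densities agree a.e., and \<open>max 0 (f t) = max 0 (- f t)\<close> forces
  \<open>f t = 0\<close>.\<close>

lemma AE_zero_if_integral_greaterThan_zero:
  fixes f :: "real \<Rightarrow> real"
  assumes f: "integrable lborel f"
    and zero: "\<And>r. (\<integral>t. indicator {r<..} t * f t \<partial>lborel) = 0"
  shows "AE t in lborel. f t = 0"
proof -
  have [measurable]: "f \<in> borel_measurable borel"
    using borel_measurable_integrable[OF f] by simp
  let ?p = "\<lambda>t. ennreal (max 0 (f t))" and ?m = "\<lambda>t. ennreal (max 0 (- f t))"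
  have ip: "integrable lborel (\<lambda>t. indicator {r<..} t * max 0 (f t))"
    and im: "integrable lborel (\<lambda>t. indicator {r<..} t * max 0 (- f t))" for r
    by (rule Bochner_Integration.integrable_bound[OF f]; auto simp: indicator_def)+
  have nn: "emeasure (density lborel ?p) {r<..} = ennreal (\<integral>t. indicator {r<..} t * max 0 (f t) \<partial>lborel)"
    "emeasure (density lborel ?m) {r<..} = ennreal (\<integral>t. indicator {r<..} t * max 0 (- f t) \<partial>lborel)" for r
    by (subst nn_integral_eq_integral[symmetric, OF ip] nn_integral_eq_integral[symmetric, OF im];
        auto simp: emeasure_density intro!: nn_integral_cong split: split_indicator)+
  have "(\<integral>t. indicator {r<..} t * max 0 (f t) \<partial>lborel) = (\<integral>t. indicator {r<..} t * max 0 (- f t) \<partial>lborel)" for r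
  proof -
    have "(\<integral>t. indicator {r<..} t * max 0 (f t) \<partial>lborel) - (\<integral>t. indicator {r<..} t * max 0 (- f t) \<partial>lborel)
        = (\<integral>t. indicator {r<..} t * f t \<partial>lborel)"
      by (subst Bochner_Integration.integral_diff[symmetric, OF ip im])
        (auto intro!: Bochner_Integration.integral_cong simp: indicator_def max_def)
    then show ?thesis using zero by simp
  qed
  then have "density lborel ?p = density lborel ?m"
    by (intro measure_eqI_lessThan) (simp_all add: nn)
  then have "AE t in lborel. ?p t = ?m t"
    by (intro sigma_finite_measure.density_unique[OF sigma_finite_lborel]) auto
  then show ?thesis
    by (rule AE_mp) (auto intro!: AE_I2 simp: max_def split: if_splits)
qed

text \<open>Since \<open>y\<close> occurs both in the bound and in the integrand, the moment is
  split as \<open>y * ?I y - ?J y\<close>. In its derivative the terms \<open>y * W y\<close> cancel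
  and \<open>?I y\<close> remains, with derivative \<open>W y\<close>. Two-sided derivatives are
  taken at interior points; continuity of \<open>W\<close> supplies the endpoints.\<close>

lemma zero_if_linear_moments_zero:
  fixes W :: "real \<Rightarrow> real"
  assumes W: "continuous_on {0..X} W" and "0 < X"
    and zero: "\<And>y. y \<in> {0..X} \<Longrightarrow> integral {0..y} (\<lambda>x. (y - x) * W x) = 0"
    and "x \<in> {0..X}"
  shows "W x = 0"
proof -
  let ?I = "\<lambda>y. integral {0..y} W" and ?J = "\<lambda>y. integral {0..y} (\<lambda>x. x * W x)"
  have xW: "continuous_on {0..X} (\<lambda>x. x * W x)" by (intro continuous_intros W)
  have I: "(?I has_real_derivative W y) (at y within {0..X})"
    and J: "(?J has_real_derivative y * W y) (at y within {0..X})" if "y \<in> {0..X}" for y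
    using integral_has_real_derivative[OF W that] integral_has_real_derivative[OF xW that] by auto
  have H: "y * ?I y - ?J y = 0" if y: "y \<in> {0..X}" for y
  proof -
    have i: "W integrable_on {0..y}" "(\<lambda>x. x * W x) integrable_on {0..y}"
      using y by (auto intro!: integrable_continuous_real continuous_on_subset[OF W] continuous_on_subset[OF xW])
    have "integral {0..y} (\<lambda>x. (y - x) * W x) = integral {0..y} (\<lambda>x. y * W x - x * W x)"
      by (simp add: algebra_simps)
    also have "\<dots> = y * ?I y - ?J y"
      using Henstock_Kurzweil_Integration.integral_diff[OF integrable_on_mult_right[OF i(1)] i(2)]
      by simp
    finally show ?thesis using zero[OF y] by simp
  qed
  have I0: "?I y = 0" if y: "y \<in> {0<..<X}" for y
  proof -
    have at: "at y within {0..X} = at y" using y by (simp add: at_within_Icc_at)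
    have y': "y \<in> {0..X}" using y by simp
    have "((\<lambda>y. y * ?I y - ?J y) has_real_derivative (1 * ?I y + W y * y) - y * W y) (at y within {0..X})"
      by (intro DERIV_diff DERIV_mult DERIV_ident I[OF y'] J[OF y'])
    then have "((\<lambda>y. y * ?I y - ?J y) has_real_derivative ?I y) (at y)" by (simp add: at mult.commute)
    then have "((\<lambda>y. 0) has_real_derivative ?I y) (at y)"
      by (rule has_field_derivative_transform_within_open[where S = "{0<..<X}"]) (use H y in auto)
    then show ?thesis using DERIV_unique[OF DERIV_const] by metis
  qed
  have W0: "W y = 0" if y: "y \<in> {0<..<X}" for y
  proof -
    have "(?I has_real_derivative W y) (at y)"
      using I[of y] y by (simp add: at_within_Icc_at)
    then have "((\<lambda>y. 0) has_real_derivative W y) (at y)"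
      by (rule has_field_derivative_transform_within_open[where S = "{0<..<X}"]) (use I0 y in auto)
    then show ?thesis using DERIV_unique[OF DERIV_const] by metis
  qed
  have cl: "closure {0<..<X} = {0..X}" using \<open>0 < X\<close> by simp
  show ?thesis
    using continuous_constant_on_closure[of "{0<..<X}" W 0 x] W W0 assms(4) unfolding cl by blast
qed

section \<open>C1 approximation of a step and the resulting test functions\<close>

text \<open>With \<open>s = (max 0 y)\<^sup>2\<close> this is \<open>m * s / (1 + m * s)\<close>:
  zero for \<open>y \<le> 0\<close>, tending to 1 for \<open>y > 0\<close> as \<open>m\<close>
  grows, with values in the unit interval. The square makes it C1 at 0.\<close>

definition smooth_step :: "real \<Rightarrow> real \<Rightarrow> real" where
  "smooth_step m y = m * (max 0 y)\<^sup>2 / (1 + m * (max 0 y)\<^sup>2)"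

lemma max_0_squared_has_derivative:
  "((\<lambda>y. (max 0 y)\<^sup>2) has_real_derivative 2 * max 0 y) (at (y :: real))"
proof (cases y "0 :: real" rule: linorder_cases)
  case less
  have "((\<lambda>y. 0) has_real_derivative 2 * max 0 y) (at y)" using less by simp
  then show ?thesis
    by (rule has_field_derivative_transform_within_open[where S = "{..<0}"]) (use less in auto)
next
  case greater
  have "((\<lambda>y. y\<^sup>2) has_real_derivative 2 * max 0 y) (at y)"
    using greater by (auto intro!: derivative_eq_intros)
  then show ?thesis
    by (rule has_field_derivative_transform_within_open[where S = "{0<..}"]) (use greater in auto)
next
  case equal
  have "((\<lambda>h. max 0 h) \<longlongrightarrow> max 0 0) (at (0 :: real))" by (intro tendsto_intros)
  moreover have "\<forall>\<^sub>F h in at (0 :: real). max 0 h = (max 0 h)\<^sup>2 / h"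
    by (auto simp: eventually_at_filter max_def power2_eq_square)
  ultimately have "((\<lambda>h. (max 0 h)\<^sup>2 / h) \<longlongrightarrow> max 0 0) (at (0 :: real))"
    by (rule Lim_transform_eventually)
  then show ?thesis using equal by (simp add: DERIV_def)
qed

lemma smooth_step_denominator: "0 \<le> m \<Longrightarrow> 0 < 1 + m * (max 0 y)\<^sup>2" for m y :: real
  by (simp add: add_pos_nonneg)

lemma smooth_step_has_derivative:
  assumes "0 \<le> m"
  shows "(smooth_step m has_real_derivative 2 * m * max 0 y / (1 + m * (max 0 y)\<^sup>2)\<^sup>2) (at y)"
proof -
  have nz: "1 + m * (max 0 y)\<^sup>2 \<noteq> 0" using smooth_step_denominator[OF assms, of y] by linarith
  have D: "((\<lambda>y. m * (max 0 y)\<^sup>2) has_real_derivative m * (2 * max 0 y)) (at y)"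
    by (rule DERIV_cmult[OF max_0_squared_has_derivative])
  have "((\<lambda>y. m * (max 0 y)\<^sup>2 / (1 + m * (max 0 y)\<^sup>2)) has_real_derivative
      (m * (2 * max 0 y) * (1 + m * (max 0 y)\<^sup>2) - m * (max 0 y)\<^sup>2 * (0 + m * (2 * max 0 y)))
        / ((1 + m * (max 0 y)\<^sup>2) * (1 + m * (max 0 y)\<^sup>2))) (at y)"
    by (rule DERIV_divide[OF D DERIV_add[OF DERIV_const D] nz])
  then show ?thesis
    unfolding smooth_step_def[abs_def] by (simp add: power2_eq_square algebra_simps)
qed

lemma smooth_step_bounds:
  assumes "0 \<le> m"
  shows "0 \<le> smooth_step m y" "smooth_step m y \<le> 1"
  using smooth_step_denominator[OF assms, of y] assms by (auto simp: smooth_step_def divide_simps)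

lemma smooth_step_nonpos: "y \<le> 0 \<Longrightarrow> smooth_step m y = 0"
  by (simp add: smooth_step_def)

lemma continuous_on_smooth_step: "0 \<le> m \<Longrightarrow> continuous_on S (smooth_step m)"
  by (meson DERIV_continuous_on has_field_derivative_at_within smooth_step_has_derivative)

lemma smooth_step_tendsto_indicator:
  "(\<lambda>m. smooth_step (real m) y) \<longlonglongrightarrow> indicator {0<..} y"
proof (cases "y \<le> 0")
  case True
  then show ?thesis by (simp add: smooth_step_nonpos)
next
  case False
  then have "(\<lambda>m. 1 - 1 / (1 + real m * y\<^sup>2)) \<longlonglongrightarrow> 1 - 0"
    by (intro tendsto_diff tendsto_const tendsto_divide_0[OF tendsto_const]
        filterlim_at_top_imp_at_infinity filterlim_tendsto_add_at_top[OF tendsto_const]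
        filterlim_at_top_mult_tendsto_pos[OF tendsto_const _ filterlim_real_sequentially]) auto
  moreover have "1 - 1 / (1 + real m * y\<^sup>2) = smooth_step (real m) y" for m
    using smooth_step_denominator[of "real m" y] False
    by (simp add: smooth_step_def field_simps max_def)
  ultimately show ?thesis using False by simp
qed

text \<open>The transport operator acts on the square only, leaving the linear factor
  \<open>max 0 (x1 - x)\<close>. \<open>\<phi>\<close> vanishes at \<open>x = \<omega>\<close> since
  \<open>x1 \<le> \<omega>\<close>. At \<open>t = T\<close> it vanishes for \<open>x > x1\<close> by
  the square and for \<open>x \<le> x1\<close> because \<open>c + x1 / lam \<le> T\<close> makes the
  argument of \<open>smooth_step\<close> nonpositive.\<close>

lemma transport_test_function:
  assumes pos: "0 < lam" "0 < \<omega>" "0 < T" "0 \<le> m" and x1: "x1 \<le> \<omega>" and c: "c + x1 / lam \<le> T"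
  defines "\<phi> \<equiv> \<lambda>y. smooth_step m (c - fst y + snd y / lam) * (max 0 (x1 - snd y))\<^sup>2"
  shows "\<phi> \<in> test_functions \<omega> T"
    and "dt \<phi> t x + lam * dx \<phi> t x
      = - 2 * lam * (smooth_step m (c - t + x / lam) * max 0 (x1 - x))"
proof -
  let ?A = "smooth_step m" and ?A' = "\<lambda>y. 2 * m * max 0 y / (1 + m * (max 0 y)\<^sup>2)\<^sup>2"
  define p where "p y = - ?A' (c - fst y + snd y / lam) * (max 0 (x1 - snd y))\<^sup>2" for y :: "real \<times> real"
  define q where "q y = ?A' (c - fst y + snd y / lam) / lam * (max 0 (x1 - snd y))\<^sup>2
    - ?A (c - fst y + snd y / lam) * (2 * max 0 (x1 - snd y))" for y :: "real \<times> real"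
  have dA: "(?A has_derivative (\<lambda>h. ?A' y * h)) (at y)" for y
    using smooth_step_has_derivative[OF pos(4)] unfolding has_field_derivative_def .
  have dB: "((\<lambda>y. (max 0 y)\<^sup>2) has_derivative (\<lambda>h. 2 * max 0 y * h)) (at y)" for y :: real
    using max_0_squared_has_derivative unfolding has_field_derivative_def .
  have D: "(\<phi> has_derivative (\<lambda>h. p y * fst h + q y * snd h)) (at y)" for y
  proof -
    have "((\<lambda>y. ?A (c - fst y + snd y / lam)) has_derivative
        (\<lambda>h. ?A' (c - fst y + snd y / lam) * (- fst h + snd h / lam))) (at y)"
      by (rule has_derivative_compose[OF _ dA]) (use pos in \<open>auto intro!: derivative_eq_intros\<close>)
    moreover have "((\<lambda>y. (max 0 (x1 - snd y))\<^sup>2) has_derivative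
        (\<lambda>h. 2 * max 0 (x1 - snd y) * (- snd h))) (at y)"
      by (rule has_derivative_compose[OF _ dB]) (auto intro!: derivative_eq_intros)
    ultimately have "(\<phi> has_derivative (\<lambda>h. ?A (c - fst y + snd y / lam) * (2 * max 0 (x1 - snd y) * (- snd h))
        + ?A' (c - fst y + snd y / lam) * (- fst h + snd h / lam) * (max 0 (x1 - snd y))\<^sup>2)) (at y)"
      unfolding \<phi>_def by (rule has_derivative_mult)
    moreover have "A * (2 * M * (- b)) + A' * (- a + b / lam) * M\<^sup>2
        = (- A' * M\<^sup>2) * a + (A' / lam * M\<^sup>2 - A * (2 * M)) * b" for A A' M a b :: real
      using pos by (simp add: field_simps)
    ultimately show ?thesis
      unfolding p_def q_def by (simp only:)
  qed
  have den: "(1 + m * (max 0 y)\<^sup>2)\<^sup>2 \<noteq> 0" for y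
    using smooth_step_denominator[OF pos(4), of y] by simp
  have cA: "continuous_on UNIV (\<lambda>y. ?A (c - fst y + snd y / lam))"
    by (rule continuous_on_compose2[OF continuous_on_smooth_step[OF pos(4), of UNIV]])
      (use pos in \<open>auto intro!: continuous_intros\<close>)
  have cont: "continuous_on UNIV p" "continuous_on UNIV q"
    unfolding p_def q_def using den pos by (intro continuous_intros cA; simp)+
  have cphi: "continuous_on UNIV \<phi>"
    using D by (meson continuous_at_imp_continuous_on has_derivative_continuous)
  have "\<phi> \<in> C1_closure ({0<..<T} \<times> {0<..<\<omega>})"
    unfolding C1_closure_def
    by (intro CollectI conjI exI[of _ p] exI[of _ q] ballI D continuous_on_subset[OF cphi]
        continuous_on_subset[OF cont(1)] continuous_on_subset[OF cont(2)] subset_UNIV)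
  moreover have "\<phi> (t, \<omega>) = 0" for t
    using x1 by (simp add: \<phi>_def)
  moreover have "\<phi> (T, x) = 0" for x
  proof (cases "x \<le> x1")
    case True
    then have "x / lam \<le> x1 / lam" using pos by (simp add: divide_right_mono)
    then have "c - T + x / lam \<le> 0" using c by linarith
    then show ?thesis by (simp add: \<phi>_def smooth_step_nonpos)
  qed (simp add: \<phi>_def)
  ultimately show "\<phi> \<in> test_functions \<omega> T"
    by (simp add: test_functions_def)
  have "((\<lambda>s. \<phi> (s, x)) has_derivative (\<lambda>h. p (t, x) * fst (h, 0::real) + q (t, x) * snd (h, 0::real))) (at t)"
    by (rule has_derivative_compose[where f = "\<lambda>s. (s, x)" and s = UNIV, OF _ D, simplified])
      (auto intro!: derivative_eq_intros)
  then have "((\<lambda>s. \<phi> (s, x)) has_real_derivative p (t, x)) (at t)"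
    by (simp add: has_field_derivative_def)
  moreover have "((\<lambda>y. \<phi> (t, y)) has_derivative (\<lambda>h. p (t, x) * fst (0::real, h) + q (t, x) * snd (0::real, h))) (at x)"
    by (rule has_derivative_compose[where f = "\<lambda>y. (t, y)" and s = UNIV, OF _ D, simplified])
      (auto intro!: derivative_eq_intros)
  then have "((\<lambda>y. \<phi> (t, y)) has_real_derivative q (t, x)) (at x)"
    by (simp add: has_field_derivative_def)
  ultimately have "dt \<phi> t x + lam * dx \<phi> t x = p (t, x) + lam * q (t, x)"
    by (simp add: dt_def dx_def DERIV_imp_deriv)
  also have "\<dots> = - 2 * lam * (?A (c - t + x / lam) * max 0 (x1 - x))"
    using pos by (simp add: p_def q_def field_simps)
  finally show "dt \<phi> t x + lam * dx \<phi> t x = - 2 * lam * (?A (c - t + x / lam) * max 0 (x1 - x))" .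
qed


section \<open>Continuous curves in L1\<close>

text \<open>The increment splits into \<open>V t x\<close> against the change of the weight, which
  tends to 0 by dominated convergence, and the change of \<open>V\<close> against a weight bounded
  by 1, which is controlled by L1-continuity.\<close>

lemma continuous_L1_weighted_integral:
  fixes V :: "real \<Rightarrow> real \<Rightarrow> real"
  assumes V: "\<And>x. x \<in> S \<Longrightarrow> integrable lborel (\<lambda>t. V t x)"
    and cont: "\<And>X x. x \<in> S \<Longrightarrow> (\<And>n. X n \<in> S) \<Longrightarrow> X \<longlonglongrightarrow> x \<Longrightarrow>
      (\<lambda>n. \<integral>t. \<bar>V t (X n) - V t x\<bar> \<partial>lborel) \<longlonglongrightarrow> 0"
    and A: "continuous_on UNIV A" "\<And>y :: real. \<bar>A y\<bar> \<le> 1"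
  shows "continuous_on S (\<lambda>x. \<integral>t. V t x * A (c - t + x / lam) \<partial>lborel)"
  unfolding continuous_on_sequentially
proof (intro allI ballI impI)
  fix X x assume "x \<in> S" and X: "(\<forall>n. X n \<in> S) \<and> X \<longlonglongrightarrow> x"
  then have x: "x \<in> S" and Xn: "\<And>n. X n \<in> S" and lim: "X \<longlonglongrightarrow> x" by auto
  have [measurable]: "A \<in> borel_measurable borel"
    using A by (simp add: borel_measurable_continuous_onI)
  have [measurable]: "(\<lambda>t. V t y) \<in> borel_measurable borel" if "y \<in> S" for y
    using borel_measurable_integrable[OF V[OF that]] by simp
  let ?A = "\<lambda>y t. A (c - t + y / lam)"
  have le: "\<bar>v * ?A y t\<bar> \<le> \<bar>v\<bar>" for v y t
    using A(2)[of "c - t + y / lam"] by (simp add: abs_mult mult_left_le)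
  have i: "integrable lborel (\<lambda>t. V t y * ?A z t)" if "y \<in> S" for y z
    by (rule Bochner_Integration.integrable_bound[OF V[OF that]]) (use le that in auto)
  have "(\<lambda>n. \<integral>t. V t x * (?A (X n) t - ?A x t) \<partial>lborel) \<longlonglongrightarrow> (\<integral>t. 0 \<partial>(lborel :: real measure))"
  proof (rule integral_dominated_convergence[where w = "\<lambda>t. 2 * \<bar>V t x\<bar>"])
    have "\<bar>V t x * (?A (X n) t - ?A x t)\<bar> \<le> 2 * \<bar>V t x\<bar>" for n t
      using le[of "V t x" t "X n"] le[of "V t x" t x] by (simp add: right_diff_distrib)
    then show "AE t in lborel. norm (V t x * (?A (X n) t - ?A x t)) \<le> 2 * \<bar>V t x\<bar>" for n
      by simp
    have "(\<lambda>n. V t x * (?A (X n) t - ?A x t)) \<longlonglongrightarrow> V t x * (?A x t - ?A x t)" for t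
    proof -
      have "(\<lambda>n. c - t + X n / lam) \<longlonglongrightarrow> c - t + x / lam"
        unfolding divide_inverse by (intro tendsto_intros lim)
      then have "(\<lambda>n. ?A (X n) t) \<longlonglongrightarrow> ?A x t"
        by (rule continuous_on_tendsto_compose[OF A(1)]) auto
      then show ?thesis by (intro tendsto_intros)
    qed
    then show "AE t in lborel. (\<lambda>n. V t x * (?A (X n) t - ?A x t)) \<longlonglongrightarrow> 0" by simp
  qed (use V x in auto)
  moreover have "(\<lambda>n. \<integral>t. (V t (X n) - V t x) * ?A (X n) t \<partial>lborel) \<longlonglongrightarrow> 0"
  proof (rule Lim_null_comparison[OF _ cont[OF x Xn lim]], rule always_eventually, rule allI)
    fix n
    have "\<bar>\<integral>t. (V t (X n) - V t x) * ?A (X n) t \<partial>lborel\<bar>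
        \<le> (\<integral>t. \<bar>(V t (X n) - V t x) * ?A (X n) t\<bar> \<partial>lborel)"
      by (rule integral_abs_bound)
    also have "\<dots> \<le> (\<integral>t. \<bar>V t (X n) - V t x\<bar> \<partial>lborel)"
    proof (rule integral_mono)
      show "integrable lborel (\<lambda>t. \<bar>(V t (X n) - V t x) * ?A (X n) t\<bar>)"
        using i[OF Xn, of n "X n"] i[OF x, of "X n"] by (simp add: left_diff_distrib)
      show "integrable lborel (\<lambda>t. \<bar>V t (X n) - V t x\<bar>)"
        using V[OF Xn] V[OF x] by simp
    qed (rule le)
    finally show "norm (\<integral>t. (V t (X n) - V t x) * ?A (X n) t \<partial>lborel)
        \<le> (\<integral>t. \<bar>V t (X n) - V t x\<bar> \<partial>lborel)" by simp
  qed
  ultimately have "(\<lambda>n. (\<integral>t. V t x * ?A x t \<partial>lborel) + (\<integral>t. V t x * (?A (X n) t - ?A x t) \<partial>lborel)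
      + (\<integral>t. (V t (X n) - V t x) * ?A (X n) t \<partial>lborel)) \<longlonglongrightarrow> (\<integral>t. V t x * ?A x t \<partial>lborel) + 0 + 0"
    by (intro tendsto_intros) auto
  moreover have "(\<integral>t. V t x * ?A x t \<partial>lborel) + (\<integral>t. V t x * (?A (X n) t - ?A x t) \<partial>lborel)
      + (\<integral>t. (V t (X n) - V t x) * ?A (X n) t \<partial>lborel) = (\<integral>t. V t (X n) * ?A (X n) t \<partial>lborel)" for n
    using i[OF Xn, of n "X n"] i[OF x, of "X n"] i[OF x, of x]
    by (simp add: left_diff_distrib right_diff_distrib)
  ultimately show "((\<lambda>x. \<integral>t. V t x * ?A x t \<partial>lborel) \<circ> X) \<longlonglongrightarrow> (\<integral>t. V t x * ?A x t \<partial>lborel)"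
    by (simp add: o_def)
qed

lemma integrable_times_bounded:
  fixes f b :: "real \<Rightarrow> real"
  assumes "integrable lborel f" "b \<in> borel_measurable borel" "\<And>t. \<bar>b t\<bar> \<le> M"
  shows "integrable lborel (\<lambda>t. f t * b t)"
proof (rule Bochner_Integration.integrable_bound[where f = "\<lambda>t. \<bar>f t\<bar> * M"])
  have "f \<in> borel_measurable borel"
    using borel_measurable_integrable[OF assms(1)] by simp
  then show "(\<lambda>t. f t * b t) \<in> borel_measurable lborel" using assms(2) by simp
  have "0 \<le> M" using assms(3)[of 0] by linarith
  then show "AE t in lborel. norm (f t * b t) \<le> norm (\<bar>f t\<bar> * M)"
    using assms(3) by (auto simp: abs_mult intro!: AE_I2 mult_left_mono)
qed (use assms in simp)

text \<open>
  A jointly measurable representative of an element of \<open>C([0,\<omega>], L\<^sup>1(0,T))\<close>, extended by zero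
  in \<open>t\<close>.
\<close>

definition L1_curve :: "real \<Rightarrow> real \<Rightarrow> (real \<Rightarrow> real \<Rightarrow> real) \<Rightarrow> bool" where
  "L1_curve T \<omega> V \<longleftrightarrow>
     (\<lambda>(t, x). V t x) \<in> borel_measurable borel \<and>
     (\<forall>t x. t \<notin> {0<..<T} \<longrightarrow> V t x = 0) \<and>
     (\<forall>x\<in>{0..\<omega>}. integrable lborel (\<lambda>t. V t x)) \<and>
     (\<forall>X. \<forall>x\<in>{0..\<omega>}. (\<forall>n. X n \<in> {0..\<omega>}) \<longrightarrow> X \<longlonglongrightarrow> x \<longrightarrow>
        (\<lambda>n. \<integral>t. \<bar>V t (X n) - V t x\<bar> \<partial>lborel) \<longlonglongrightarrow> 0)"

lemma L1_curveD:
  assumes "L1_curve T \<omega> V"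
  shows "(\<lambda>(t, x). V t x) \<in> borel_measurable (borel \<Otimes>\<^sub>M borel)"
    and "t \<notin> {0<..<T} \<Longrightarrow> V t x = 0"
    and "x \<in> {0..\<omega>} \<Longrightarrow> integrable lborel (\<lambda>t. V t x)"
    and "x \<in> {0..\<omega>} \<Longrightarrow> (\<And>n. X n \<in> {0..\<omega>}) \<Longrightarrow> X \<longlonglongrightarrow> x \<Longrightarrow>
      (\<lambda>n. \<integral>t. \<bar>V t (X n) - V t x\<bar> \<partial>lborel) \<longlonglongrightarrow> 0"
  using assms unfolding L1_curve_def borel_prod by blast+

lemma L1_curve_diff:
  assumes V: "L1_curve T \<omega> V" and U: "L1_curve T \<omega> U"
  shows "L1_curve T \<omega> (\<lambda>t x. V t x - U t x)"
  unfolding L1_curve_def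
proof (intro conjI allI ballI impI)
  have [measurable]: "(\<lambda>(t, x). V t x) \<in> borel_measurable (borel \<Otimes>\<^sub>M borel)"
    "(\<lambda>(t, x). U t x) \<in> borel_measurable (borel \<Otimes>\<^sub>M borel)"
    using L1_curveD(1)[OF V] L1_curveD(1)[OF U] .
  have "(\<lambda>(t, x). V t x - U t x) \<in> borel_measurable (borel \<Otimes>\<^sub>M borel)" by measurable
  then show "(\<lambda>(t, x). V t x - U t x) \<in> borel_measurable borel" by (simp only: borel_prod)
  show "V t x - U t x = 0" if "t \<notin> {0<..<T}" for t x
    using L1_curveD(2)[OF V that] L1_curveD(2)[OF U that] by simp
  show "integrable lborel (\<lambda>t. V t x - U t x)" if "x \<in> {0..\<omega>}" for x
    using L1_curveD(3)[OF V that] L1_curveD(3)[OF U that] by simp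
  fix X x assume x: "x \<in> {0..\<omega>}" and "\<forall>n. X n \<in> {0..\<omega>}" and X: "X \<longlonglongrightarrow> x"
  then have Xn: "X n \<in> {0..\<omega>}" for n by blast
  have "(\<lambda>n. (\<integral>t. \<bar>V t (X n) - V t x\<bar> \<partial>lborel) + (\<integral>t. \<bar>U t (X n) - U t x\<bar> \<partial>lborel)) \<longlonglongrightarrow> 0"
    using tendsto_add[OF L1_curveD(4)[OF V x Xn X] L1_curveD(4)[OF U x Xn X]] by simp
  moreover have "norm (\<integral>t. \<bar>V t (X n) - U t (X n) - (V t x - U t x)\<bar> \<partial>lborel)
      \<le> (\<integral>t. \<bar>V t (X n) - V t x\<bar> \<partial>lborel) + (\<integral>t. \<bar>U t (X n) - U t x\<bar> \<partial>lborel)" for n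
  proof -
    note i = L1_curveD(3)[OF V Xn, of n] L1_curveD(3)[OF V x] L1_curveD(3)[OF U Xn, of n] L1_curveD(3)[OF U x]
    have "(\<integral>t. \<bar>V t (X n) - U t (X n) - (V t x - U t x)\<bar> \<partial>lborel)
        \<le> (\<integral>t. \<bar>V t (X n) - V t x\<bar> + \<bar>U t (X n) - U t x\<bar> \<partial>lborel)"
      using i by (intro integral_mono) auto
    then show ?thesis using i by simp
  qed
  ultimately show "(\<lambda>n. \<integral>t. \<bar>V t (X n) - U t (X n) - (V t x - U t x)\<bar> \<partial>lborel) \<longlonglongrightarrow> 0"
    by (rule Lim_null_comparison[OF always_eventually[OF allI], rotated])
qed

text \<open>The L1 norm of \<open>V\<close> at \<open>x\<close> is continuous in \<open>x\<close>,
  hence bounded on the compact interval, and Fubini's criterion applies. The kernel is bounded on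
  \<open>{0<..<\<omega>}\<close> only, as the kernels used contain \<open>max 0 (y - x)\<close>,
  which grows for \<open>x\<close> tending to minus infinity.\<close>

lemma L1_curve_pair_integrable:
  fixes V :: "real \<Rightarrow> real \<Rightarrow> real"
  assumes curve: "L1_curve T \<omega> V" and pos: "0 < \<omega>"
    and [measurable]: "(\<lambda>(x, t). K x t) \<in> borel_measurable (borel \<Otimes>\<^sub>M borel)"
    and bK: "\<And>x t. x \<in> {0<..<\<omega>} \<Longrightarrow> \<bar>K x t\<bar> \<le> (M :: real)"
  shows "integrable (lborel \<Otimes>\<^sub>M lborel) (\<lambda>(x, t). indicator {0<..<\<omega>} x * (V t x * K x t))"
proof -
  note V = L1_curveD(3)[OF curve] and cont = L1_curveD(4)[OF curve] and out = L1_curveD(2)[OF curve]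
  have [measurable]: "(\<lambda>(t, x). V t x) \<in> borel_measurable (borel \<Otimes>\<^sub>M borel)"
    by (rule L1_curveD(1)[OF curve])
  have "continuous_on {0..\<omega>} (\<lambda>x. \<integral>t. \<bar>V t x\<bar> \<partial>lborel)"
    unfolding continuous_on_sequentially
  proof (intro allI ballI impI)
    fix X x assume x: "x \<in> {0..\<omega>}" and X: "(\<forall>n. X n \<in> {0..\<omega>}) \<and> X \<longlonglongrightarrow> x"
    then have Xn: "X n \<in> {0..\<omega>}" for n by blast
    have "(\<lambda>n. (\<integral>t. \<bar>V t (X n)\<bar> \<partial>lborel) - (\<integral>t. \<bar>V t x\<bar> \<partial>lborel)) \<longlonglongrightarrow> 0"
    proof (rule Lim_null_comparison[OF _ cont[OF x Xn]], rule always_eventually, rule allI)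
      fix n
      have "(\<integral>t. \<bar>V t (X n)\<bar> \<partial>lborel) - (\<integral>t. \<bar>V t x\<bar> \<partial>lborel) = (\<integral>t. \<bar>V t (X n)\<bar> - \<bar>V t x\<bar> \<partial>lborel)"
        using V[OF x] V[OF Xn] by simp
      moreover have "\<bar>\<integral>t. \<bar>V t (X n)\<bar> - \<bar>V t x\<bar> \<partial>lborel\<bar> \<le> (\<integral>t. \<bar>\<bar>V t (X n)\<bar> - \<bar>V t x\<bar>\<bar> \<partial>lborel)"
        by (rule integral_abs_bound)
      moreover have "\<dots> \<le> (\<integral>t. \<bar>V t (X n) - V t x\<bar> \<partial>lborel)"
        using V[OF x] V[OF Xn] by (intro integral_mono) auto
      ultimately show "norm ((\<integral>t. \<bar>V t (X n)\<bar> \<partial>lborel) - (\<integral>t. \<bar>V t x\<bar> \<partial>lborel))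
          \<le> (\<integral>t. \<bar>V t (X n) - V t x\<bar> \<partial>lborel)"
        unfolding real_norm_def by linarith
    qed (use X in blast)
    then show "((\<lambda>x. \<integral>t. \<bar>V t x\<bar> \<partial>lborel) \<circ> X) \<longlonglongrightarrow> (\<integral>t. \<bar>V t x\<bar> \<partial>lborel)"
      by (simp add: o_def LIM_zero_iff)
  qed
  then have "bounded ((\<lambda>x. \<integral>t. \<bar>V t x\<bar> \<partial>lborel) ` {0..\<omega>})"
    by (intro compact_imp_bounded compact_continuous_image) auto
  then obtain C where "\<And>x. x \<in> {0..\<omega>} \<Longrightarrow> norm (\<integral>t. \<bar>V t x\<bar> \<partial>lborel) \<le> C"
    unfolding bounded_iff by blast
  then have C: "x \<in> {0..\<omega>} \<Longrightarrow> (\<integral>t. \<bar>V t x\<bar> \<partial>lborel) \<le> C" for x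
    unfolding real_norm_def by (rule order_trans[OF abs_ge_self])
  have M: "0 \<le> M" using bK[of "\<omega> / 2" 0] pos by force
  let ?F = "\<lambda>x t. indicator {0<..<\<omega>} x * (V t x * K x t)"
  have iF: "integrable lborel (?F x)" for x
  proof (cases "x \<in> {0<..<\<omega>}")
    case True
    have "integrable lborel (\<lambda>t. V t x * K x t)"
      by (rule integrable_times_bounded[OF V _ bK[OF True]]) (use True in auto)
    then show ?thesis by simp
  qed simp
  show "integrable (lborel \<Otimes>\<^sub>M lborel) (\<lambda>(x, t). ?F x t)"
  proof (rule lborel_pair.Fubini_integrable)
    show "AE x in lborel. integrable lborel (\<lambda>t. case (x, t) of (x, t) \<Rightarrow> ?F x t)"
      using iF by simp
    have "\<bar>\<integral>t. norm (?F x t) \<partial>lborel\<bar> \<le> (C * M) * indicator {0..\<omega>} x" for x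
    proof (cases "x \<in> {0<..<\<omega>}")
      case True
      have x: "x \<in> {0..\<omega>}" using True by simp
      have "(\<integral>t. norm (?F x t) \<partial>lborel) \<le> (\<integral>t. \<bar>V t x\<bar> * M \<partial>lborel)"
      proof (rule integral_mono)
        show "integrable lborel (\<lambda>t. norm (?F x t))" using iF by (rule integrable_norm)
        show "integrable lborel (\<lambda>t. \<bar>V t x\<bar> * M)" using V[OF x] by simp
        show "norm (?F x t) \<le> \<bar>V t x\<bar> * M" for t
          using mult_left_mono[OF bK[OF True, of t], of "\<bar>V t x\<bar>"] True by (simp add: abs_mult)
      qed
      also have "\<dots> \<le> C * M" using C[OF x] M by (simp add: mult_right_mono)
      finally show ?thesis using True by simp
    next
      case False
      have "0 \<le> (\<integral>t. \<bar>V t 0\<bar> \<partial>lborel)" by simp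
      also have "\<dots> \<le> C" using C[of 0] pos by simp
      finally have "0 \<le> C" .
      then show ?thesis using False M by simp
    qed
    then have "integrable lborel (\<lambda>x. \<integral>t. norm (?F x t) \<partial>lborel)"
      by (intro integrable_bounded_support[where B = "C * M" and a = 0 and b = \<omega>]) measurable
    then show "integrable lborel (\<lambda>x. \<integral>t. norm (case (x, t) of (x, t) \<Rightarrow> ?F x t) \<partial>lborel)"
      by simp
  qed measurable
qed

text \<open>For \<open>x > 0\<close> the moment criterion on \<open>{0..x}\<close> is used at its
  right endpoint, where the weight is a function of \<open>r - t\<close>. In the limit, the integral
  over \<open>t < r\<close> vanishes for all \<open>r \<le> T\<close>; \<open>r = T\<close> gives
  the total integral, and subtraction yields the half-lines \<open>t > r\<close>. The point
  \<open>x = 0\<close> follows by L1-continuity.\<close>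

lemma transport_weak_unique:
  fixes V :: "real \<Rightarrow> real \<Rightarrow> real"
  assumes pos: "0 < lam" "0 < \<omega>" "0 < T"
    and curve: "L1_curve T \<omega> V"
    and weak: "\<And>\<phi>. \<phi> \<in> test_functions \<omega> T \<Longrightarrow>
      (LINT t|lebesgue_on {0<..<T}. LINT x|lebesgue_on {0<..<\<omega>}. V t x * (dt \<phi> t x + lam * dx \<phi> t x)) = 0"
    and "x \<in> {0..\<omega>}"
  shows "AE t in lborel. V t x = 0"
proof -
  note V = L1_curveD(3)[OF curve] and cont = L1_curveD(4)[OF curve] and out = L1_curveD(2)[OF curve]
  have [measurable]: "(\<lambda>(t, x). V t x) \<in> borel_measurable (borel \<Otimes>\<^sub>M borel)"
    by (rule L1_curveD(1)[OF curve])
  \<comment> \<open>Fubini turns the tested equation into an integral over \<open>x\<close>; the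
    cut-off ends it at \<open>y\<close>, and the factor \<open>- 2 * lam\<close> is nonzero.\<close>
  have moments: "integral {0..y} (\<lambda>x. (y - x) * (\<integral>t. V t x * smooth_step m (c - t + x / lam) \<partial>lborel)) = 0"
    if m: "0 \<le> m" and y: "0 \<le> y" "y \<le> \<omega>" and c: "c + y / lam \<le> T" for m y c
  proof -
    let ?A = "\<lambda>x t. smooth_step m (c - t + x / lam)"
    let ?W = "\<lambda>x. \<integral>t. V t x * ?A x t \<partial>lborel"
    let ?F = "\<lambda>x t. indicator {0<..<\<omega>} x * (V t x * (?A x t * max 0 (y - x)))"
    have [measurable]: "smooth_step m \<in> borel_measurable borel"
      using continuous_on_smooth_step[OF m] by (simp add: borel_measurable_continuous_onI)
    have b: "\<bar>?A x t\<bar> \<le> 1" for x t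
      using smooth_step_bounds[OF m, of "c - t + x / lam"] by simp
    have bK: "\<bar>?A x t * max 0 (y - x)\<bar> \<le> \<omega>" if "x \<in> {0<..<\<omega>}" for x t
    proof -
      have "\<bar>?A x t\<bar> * \<bar>max 0 (y - x)\<bar> \<le> 1 * \<omega>"
        using b[where x = x and t = t] that y by (intro mult_mono) auto
      then show ?thesis by (simp add: abs_mult)
    qed
    have "integrable (lborel \<Otimes>\<^sub>M lborel) (\<lambda>(x, t). ?F x t)"
      by (rule L1_curve_pair_integrable[OF curve pos(2) _ bK]) measurable
    note Fubini = lborel_pair.Fubini_integral[OF this]
    define \<phi> where "\<phi> = (\<lambda>z. smooth_step m (c - fst z + snd z / lam) * (max 0 (y - snd z))\<^sup>2)"
    note test = transport_test_function[OF pos(1) pos(2) pos(3) m y(2) c, folded \<phi>_def]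
    have "0 = (LINT t|lebesgue_on {0<..<T}. LINT x|lebesgue_on {0<..<\<omega>}.
        V t x * (- 2 * lam * (?A x t * max 0 (y - x))))"
      using weak[OF test(1)] unfolding test(2) by simp
    also have "\<dots> = (LINT t|lebesgue_on {0<..<T}.
        (\<integral>x. indicator {0<..<\<omega>} x * (V t x * (- 2 * lam * (?A x t * max 0 (y - x)))) \<partial>lborel))"
      by (intro Bochner_Integration.integral_cong refl lebesgue_on_lborel) measurable
    also have "\<dots> = (LINT t|lebesgue_on {0<..<T}. - 2 * lam * (\<integral>x. ?F x t \<partial>lborel))"
    proof (rule Bochner_Integration.integral_cong[OF refl])
      fix t
      have "(\<integral>x. indicator {0<..<\<omega>} x * (V t x * (- 2 * lam * (?A x t * max 0 (y - x)))) \<partial>lborel)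
          = (\<integral>x. - 2 * lam * ?F x t \<partial>lborel)"
        by (rule Bochner_Integration.integral_cong[OF refl]) (simp only: ac_simps)
      then show "(\<integral>x. indicator {0<..<\<omega>} x * (V t x * (- 2 * lam * (?A x t * max 0 (y - x)))) \<partial>lborel)
          = - 2 * lam * (\<integral>x. ?F x t \<partial>lborel)" by (simp only: integral_mult_right_zero)
    qed
    also have "\<dots> = - 2 * lam * (LINT t|lebesgue_on {0<..<T}. (\<integral>x. ?F x t \<partial>lborel))"
      by (rule integral_mult_right_zero)
    also have "(LINT t|lebesgue_on {0<..<T}. (\<integral>x. ?F x t \<partial>lborel))
        = (\<integral>t. indicator {0<..<T} t * (\<integral>x. ?F x t \<partial>lborel) \<partial>lborel)"
      by (intro lebesgue_on_lborel) measurable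
    also have "\<dots> = (\<integral>t. (\<integral>x. ?F x t \<partial>lborel) \<partial>lborel)"
    proof (rule Bochner_Integration.integral_cong[OF refl])
      fix t
      show "indicator {0<..<T} t * (\<integral>x. ?F x t \<partial>lborel) = (\<integral>x. ?F x t \<partial>lborel)"
        by (cases "t \<in> {0<..<T}") (simp_all add: out)
    qed
    also have "\<dots> = (\<integral>x. (\<integral>t. ?F x t \<partial>lborel) \<partial>lborel)" by (rule Fubini)
    also have "\<dots> = (\<integral>x. indicator {0<..<y} x *\<^sub>R ((y - x) * ?W x) \<partial>lborel)"
    proof (rule Bochner_Integration.integral_cong[OF refl])
      fix x
      have "(\<integral>t. ?F x t \<partial>lborel) = (\<integral>t. (indicator {0<..<\<omega>} x * max 0 (y - x)) * (V t x * ?A x t) \<partial>lborel)"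
        by (rule Bochner_Integration.integral_cong[OF refl]) (simp only: ac_simps)
      also have "\<dots> = (indicator {0<..<\<omega>} x * max 0 (y - x)) * ?W x"
        by (rule integral_mult_right_zero)
      also have "\<dots> = indicator {0<..<y} x *\<^sub>R ((y - x) * ?W x)"
        using y by (auto simp: indicator_def)
      finally show "(\<integral>t. ?F x t \<partial>lborel) = indicator {0<..<y} x *\<^sub>R ((y - x) * ?W x)" .
    qed
    also have "\<dots> = integral {0<..<y} (\<lambda>x. (y - x) * ?W x)"
      and "integral {0<..<y} (\<lambda>x. (y - x) * ?W x) = integral {0..y} (\<lambda>x. (y - x) * ?W x)"
    proof -
      have "continuous_on {0..\<omega>} ?W"
        by (rule continuous_L1_weighted_integral[OF V cont continuous_on_smooth_step[OF m]])
          (use smooth_step_bounds[OF m] in auto)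
      then have cW: "continuous_on {0..y} (\<lambda>x. (y - x) * ?W x)"
        using y by (auto intro!: continuous_intros elim: continuous_on_subset)
      then have "set_integrable lborel {0<..<y} (\<lambda>x. (y - x) * ?W x)"
        by (rule set_integrable_subset[OF borel_integrable_atLeastAtMost']) auto
      then show "(\<integral>x. indicator {0<..<y} x *\<^sub>R ((y - x) * ?W x) \<partial>lborel)
          = integral {0<..<y} (\<lambda>x. (y - x) * ?W x)"
        using set_borel_integral_eq_integral(2) unfolding set_lebesgue_integral_def by blast
      have "((\<lambda>x. (y - x) * ?W x) has_integral integral {0..y} (\<lambda>x. (y - x) * ?W x)) {0..y}"
        using cW by (intro integrable_integral integrable_continuous_real)
      then show "integral {0<..<y} (\<lambda>x. (y - x) * ?W x) = integral {0..y} (\<lambda>x. (y - x) * ?W x)"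
        by (intro integral_unique) (simp add: has_integral_Icc_iff_Ioo)
    qed
    ultimately show ?thesis using pos by auto
  qed
  have AE0: "AE t in lborel. V t x = 0" if x: "x \<in> {0<..\<omega>}" for x
  proof -
    have Vx: "integrable lborel (\<lambda>t. V t x)" using V x by simp
    have [measurable]: "(\<lambda>t. V t x) \<in> borel_measurable borel" by measurable
    have le: "(\<integral>t. V t x * indicator {0<..} (r - t) \<partial>lborel) = 0" if "r \<le> T" for r
    proof -
      \<comment> \<open>At the position \<open>x\<close> the weight is then
        \<open>smooth_step m (r - t)\<close>, and \<open>c + y / lam \<le> r \<le> T\<close> holds
        for all \<open>y \<le> x\<close>, as \<open>moments\<close> requires.\<close>
      define c where "c = r - x / lam"
      have "(\<integral>t. V t x * smooth_step (real m) (r - t) \<partial>lborel) = 0" for m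
      proof -
        let ?W = "\<lambda>x. \<integral>t. V t x * smooth_step (real m) (c - t + x / lam) \<partial>lborel"
        have "continuous_on {0..\<omega>} ?W"
          by (rule continuous_L1_weighted_integral[OF V cont continuous_on_smooth_step])
            (use smooth_step_bounds in auto)
        then have "continuous_on {0..x} ?W" by (rule continuous_on_subset) (use x in auto)
        then have "?W x = 0"
        proof (rule zero_if_linear_moments_zero)
          fix y assume y: "y \<in> {0..x}"
          then have "y / lam \<le> x / lam" using pos by (simp add: divide_right_mono)
          then show "integral {0..y} (\<lambda>x. (y - x) * ?W x) = 0"
            using y x that by (intro moments) (auto simp: c_def)
        qed (use x in auto)
        then show ?thesis by (simp add: c_def algebra_simps)
      qed
      moreover have "(\<lambda>m. \<integral>t. V t x * smooth_step (real m) (r - t) \<partial>lborel)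
          \<longlonglongrightarrow> (\<integral>t. V t x * indicator {0<..} (r - t) \<partial>lborel)"
      proof (rule integral_dominated_convergence[where w = "\<lambda>t. \<bar>V t x\<bar>"])
        show "(\<lambda>t. V t x * smooth_step (real m) (r - t)) \<in> borel_measurable lborel" for m
        proof -
          have [measurable]: "smooth_step (real m) \<in> borel_measurable borel"
            by (simp add: borel_measurable_continuous_onI continuous_on_smooth_step)
          show ?thesis by measurable
        qed
        show "AE t in lborel. norm (V t x * smooth_step (real m) (r - t)) \<le> \<bar>V t x\<bar>" for m
          using smooth_step_bounds[of "real m"] by (auto simp: abs_mult intro!: mult_left_le)
        show "AE t in lborel. (\<lambda>m. V t x * smooth_step (real m) (r - t))
            \<longlonglongrightarrow> V t x * indicator {0<..} (r - t)"
          by (intro AE_I2 tendsto_intros smooth_step_tendsto_indicator)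
      qed (use Vx in auto)
      ultimately show ?thesis by (simp add: LIMSEQ_const_iff)
    qed
    have total: "(\<integral>t. V t x \<partial>lborel) = 0"
    proof -
      have "V t x = V t x * indicator {0<..} (T - t)" for t
        using out[of t x] by (auto simp: indicator_def)
      then have "(\<integral>t. V t x \<partial>lborel) = (\<integral>t. V t x * indicator {0<..} (T - t) \<partial>lborel)"
        by (rule Bochner_Integration.integral_cong[OF refl])
      then show ?thesis using le[of T] by simp
    qed
    have "(\<integral>t. indicator {r<..} t * V t x \<partial>lborel) = 0" for r
    proof (cases "r \<le> T")
      case True
      \<comment> \<open>The complement of \<open>t < r\<close> is \<open>t \<ge> r\<close>; it
        differs from \<open>{r<..}\<close> by a single point.\<close>
      have "AE t in lborel. t \<noteq> r" by (rule AE_lborel_singleton)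
      then have "AE t in lborel. indicator {r<..} t * V t x = V t x - V t x * indicator {0<..} (r - t)"
        by eventually_elim (auto simp: indicator_def)
      then have "(\<integral>t. indicator {r<..} t * V t x \<partial>lborel) = (\<integral>t. V t x - V t x * indicator {0<..} (r - t) \<partial>lborel)"
        by (intro integral_cong_AE) auto
      also have "\<dots> = (\<integral>t. V t x \<partial>lborel) - (\<integral>t. V t x * indicator {0<..} (r - t) \<partial>lborel)"
        by (rule Bochner_Integration.integral_diff[OF Vx integrable_times_bounded[OF Vx, of _ 1]])
          (auto simp: indicator_def)
      finally show ?thesis using total le[OF True] by simp
    next
      case False
      have "indicator {r<..} t * V t x = 0" for t
        using False out[of t x] by (auto simp: indicator_def)
      then have "(\<integral>t. indicator {r<..} t * V t x \<partial>lborel) = (\<integral>t. 0 \<partial>(lborel :: real measure))"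
        by (simp only:)
      then show ?thesis by simp
    qed
    then show ?thesis by (rule AE_zero_if_integral_greaterThan_zero[OF Vx])
  qed
  show ?thesis
  proof (cases "x = 0")
    case False
    then show ?thesis using AE0 \<open>x \<in> {0..\<omega>}\<close> by simp
  next
    case True
    \<comment> \<open>Positive positions tending to 0; the values of \<open>V\<close> there vanish
      a.e.\<close>
    define X where "X n = \<omega> / real (Suc n)" for n
    have X: "X n \<in> {0<..\<omega>}" for n
      using pos by (simp add: X_def divide_le_eq)
    have "X \<longlonglongrightarrow> 0"
      unfolding X_def by (rule LIMSEQ_Suc[OF lim_const_over_n])
    then have "(\<lambda>n. \<integral>t. \<bar>V t (X n) - V t 0\<bar> \<partial>lborel) \<longlonglongrightarrow> 0"
      using X pos by (intro cont) (auto simp: less_imp_le)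
    moreover have "(\<integral>t. \<bar>V t (X n) - V t 0\<bar> \<partial>lborel) = (\<integral>t. \<bar>V t 0\<bar> \<partial>lborel)" for n
      using AE0[OF X[of n]] by (intro integral_cong_AE) auto
    ultimately have "(\<integral>t. \<bar>V t 0\<bar> \<partial>lborel) = 0" by (simp add: LIMSEQ_const_iff)
    then show ?thesis
      using integral_nonneg_eq_0_iff_AE[of lborel "\<lambda>t. \<bar>V t 0\<bar>"] V[of 0] pos True by simp
  qed
qed


section \<open>Representatives and norms\<close>

lemma AE_lebesgue_on_iff:
  "(AE t in lebesgue_on {a<..<b :: real}. P t) \<longleftrightarrow> (AE t in lborel. t \<in> {a<..<b} \<longrightarrow> P t)"
  by (simp add: AE_restrict_space_iff AE_completion_iff)

text \<open>\<open>P\<close> need not be measurable, so the exceptional set is enlarged to a Borel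
  null set before translation invariance is applied.\<close>

lemma AE_lborel_translate:
  assumes "AE t in lborel. P t"
  shows "AE t in lborel. P (t - s :: real)"
proof -
  obtain N where N: "N \<in> null_sets lborel" "{t. \<not> P t} \<subseteq> N"
    using assms by (auto elim!: AE_E simp: null_sets_def)
  have [measurable]: "N \<in> sets borel" using N by auto
  have "AE t in lborel. t \<notin> N" by (rule AE_not_in[OF N(1)])
  then have "AE t in distr lborel borel ((+) (- s)). t \<notin> N"
    by (subst lborel_distr_plus)
  then have "AE t in lborel. - s + t \<notin> N"
    by (subst (asm) AE_distr_iff) auto
  then show ?thesis
    by (rule AE_mp) (use N(2) in \<open>auto intro!: AE_I2 simp: add.commute\<close>)
qed

text \<open>For \<open>t\<close> below \<open>T\<close> and \<open>0 \<le> y\<close>, a positive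
  delayed time \<open>t - y\<close> stays in \<open>{0<..<T}\<close>, where \<open>f = g\<close>
  a.e.; at nonpositive times \<open>g\<close> is zero. So the case distinction of the formula is
  absorbed into \<open>g\<close>.\<close>

lemma AE_lebesgue_on_delay:
  fixes f g :: "real \<Rightarrow> real"
  assumes "AE s in lebesgue_on {0<..<T}. f s = g s" and "0 \<le> y"
    and g0: "\<And>s. s \<le> 0 \<Longrightarrow> g s = 0"
  shows "AE t in lebesgue_on {0<..<T}. (if t - y > 0 then a * f (t - y) else 0) = a * g (t - y)"
proof -
  have "AE t in lborel. t - y \<in> {0<..<T} \<longrightarrow> f (t - y) = g (t - y)"
    using assms(1) by (intro AE_lborel_translate) (simp add: AE_lebesgue_on_iff)
  then have "AE t in lborel. t \<in> {0<..<T} \<longrightarrow>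
      (if t - y > 0 then a * f (t - y) else 0) = a * g (t - y)"
    by eventually_elim (use \<open>0 \<le> y\<close> g0 in auto)
  then show ?thesis by (simp add: AE_lebesgue_on_iff)
qed

lemma borel_measurable_lebesgue_on:
  "f \<in> borel_measurable borel \<Longrightarrow> f \<in> borel_measurable (lebesgue_on S)"
  by (intro measurable_restrict_space1 measurable_completion) simp

section \<open>Square-integrable functions on a bounded interval\<close>

text \<open>An element of \<open>L2 T\<close> is only Lebesgue measurable and arbitrary outside the
  interval. Translations and joint measurability in \<open>(t, x)\<close> call for a Borel function
  on the whole line.\<close>

lemma L2_borel_version:
  assumes u: "u \<in> L2 T"
  obtains u0 where "u0 \<in> borel_measurable borel" "\<forall>t. t \<notin> {0<..<T} \<longrightarrow> u0 t = 0"
    "AE t in lebesgue_on {0<..<T}. u t = u0 t" "integrable lborel (\<lambda>t. (u0 t)\<^sup>2)"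
    "(\<integral>t. (u0 t)\<^sup>2 \<partial>lborel) = (L2_norm T u)\<^sup>2"
proof -
  let ?S = "{0<..<T}"
  have u': "u \<in> borel_measurable (lebesgue_on ?S)" "integrable (lebesgue_on ?S) (\<lambda>t. (u t)\<^sup>2)"
    using u by (auto simp: L2_def)
  then have "(\<lambda>t. indicator ?S t *\<^sub>R u t) \<in> borel_measurable lebesgue"
    by (subst (asm) borel_measurable_restrict_space_iff) auto
  then obtain g where g [measurable]: "g \<in> borel_measurable lborel"
    and ae: "AE t in lborel. indicator ?S t *\<^sub>R u t = g t"
    using completion_ex_borel_measurable_real by blast
  define u0 where "u0 t = indicator ?S t * g t" for t
  have m [measurable]: "u0 \<in> borel_measurable borel" unfolding u0_def by measurable
  have eq: "AE t in lebesgue_on ?S. u t = u0 t"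
    unfolding AE_lebesgue_on_iff using ae by eventually_elim (auto simp: u0_def)
  have m2: "(\<lambda>t. (u0 t)\<^sup>2) \<in> borel_measurable borel" by measurable
  have ind: "indicator ?S t * (u0 t)\<^sup>2 = (u0 t)\<^sup>2" for t by (simp add: u0_def indicator_def)
  have eq2: "AE t in lebesgue_on ?S. (u t)\<^sup>2 = (u0 t)\<^sup>2" using eq by eventually_elim simp
  have "integrable (lebesgue_on ?S) (\<lambda>t. (u0 t)\<^sup>2)"
    using u'(2) integrable_cong_AE[OF _ _ eq2] u'(1) borel_measurable_lebesgue_on[OF m2]
    by (simp add: borel_measurable_power)
  then have int: "integrable lborel (\<lambda>t. (u0 t)\<^sup>2)"
    using lebesgue_on_lborel(1)[OF m2] by (simp add: ind)
  have "(\<integral>t. (u0 t)\<^sup>2 \<partial>lborel) = (LINT t|lebesgue_on ?S. (u0 t)\<^sup>2)"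
    using lebesgue_on_lborel(2)[OF m2] by (simp add: ind)
  also have "\<dots> = (LINT t|lebesgue_on ?S. (u t)\<^sup>2)"
    using integral_cong_AE[OF _ _ eq2] u'(1) borel_measurable_lebesgue_on[OF m2]
    by (simp add: borel_measurable_power)
  also have "\<dots> = (L2_norm T u)\<^sup>2" by (simp add: L2_norm_def)
  finally show ?thesis using that[of u0] m eq int by (simp add: u0_def)
qed

lemma L2_integrable:
  assumes f: "f \<in> L2 T"
  shows "integrable (lebesgue_on {0<..<T}) f"
proof (rule Bochner_Integration.integrable_bound[where f = "\<lambda>t. 1 + (f t)\<^sup>2"])
  have "emeasure lebesgue {0<..<T} < \<infinity>"
    by (cases "0 \<le> T") auto
  then have "integrable (lebesgue_on {0<..<T}) (\<lambda>t. 1 :: real)"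
    by (simp add: integrable_restrict_space)
  then show "integrable (lebesgue_on {0<..<T}) (\<lambda>t. 1 + (f t)\<^sup>2)"
    using f by (simp add: L2_def)
  show "AE t in lebesgue_on {0<..<T}. norm (f t) \<le> norm (1 + (f t)\<^sup>2)"
  proof (rule AE_I2)
    fix t
    have "0 \<le> (\<bar>f t\<bar> - 1)\<^sup>2" by simp
    then show "norm (f t) \<le> norm (1 + (f t)\<^sup>2)"
      by (simp add: power2_eq_square algebra_simps abs_mult_self_eq)
  qed
qed (use f in \<open>simp add: L2_def\<close>)

text \<open>Cauchy-Schwarz against the constant 1, obtained from the nonnegative variance of
  \<open>\<bar>f t\<bar>\<close>; \<open>a\<close> is its mean.\<close>

lemma L1_le_L2_norm:
  assumes f: "f \<in> L2 T" and "0 < T"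
  shows "(LINT t|lebesgue_on {0<..<T}. \<bar>f t\<bar>) \<le> sqrt T * L2_norm T f"
proof -
  let ?M = "lebesgue_on {0<..<T}"
  let ?I = "LINT t|?M. \<bar>f t\<bar>" and ?J = "LINT t|?M. (f t)\<^sup>2"
  have i: "integrable ?M (\<lambda>t. \<bar>f t\<bar>)" "integrable ?M (\<lambda>t. (f t)\<^sup>2)" "integrable ?M (\<lambda>t. c)" for c :: real
    using L2_integrable[OF f] f \<open>0 < T\<close> by (auto simp: L2_def integrable_restrict_space)
  define a where "a = ?I / T"
  have "0 \<le> (LINT t|?M. (\<bar>f t\<bar> - a)\<^sup>2)" by simp
  also have "\<dots> = (LINT t|?M. (f t)\<^sup>2 - 2 * a * \<bar>f t\<bar> + a\<^sup>2)"
    by (intro Bochner_Integration.integral_cong refl) (simp add: power2_diff)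
  also have "\<dots> = ?J - 2 * a * ?I + (LINT t|?M. a\<^sup>2)"
    using i by simp
  also have "(LINT t|?M. a\<^sup>2) = a\<^sup>2 * T"
    using \<open>0 < T\<close> by (simp add: measure_restrict_space)
  also have "?J - 2 * a * ?I + a\<^sup>2 * T = ?J - ?I\<^sup>2 / T"
    using \<open>0 < T\<close> by (simp add: a_def power2_eq_square field_simps)
  finally have "?I\<^sup>2 \<le> T * ?J" using \<open>0 < T\<close> by (simp add: field_simps)
  then have "?I \<le> sqrt (T * ?J)" by (rule real_le_rsqrt)
  then show ?thesis by (simp add: real_sqrt_mult L2_norm_def)
qed

lemma L2_diff:
  assumes f: "f \<in> L2 T" and g: "g \<in> L2 T"
  shows "(\<lambda>t. f t - g t) \<in> L2 T"
proof -
  have m: "f \<in> borel_measurable (lebesgue_on {0<..<T})" "g \<in> borel_measurable (lebesgue_on {0<..<T})"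
    using f g by (auto simp: L2_def)
  have "integrable (lebesgue_on {0<..<T}) (\<lambda>t. (f t - g t)\<^sup>2)"
    by (rule Bochner_Integration.integrable_bound[where f = "\<lambda>t. 2 * (f t)\<^sup>2 + 2 * (g t)\<^sup>2"])
      (use f g m diff_squared_le in \<open>auto simp: L2_def\<close>)
  then show ?thesis using m by (simp add: L2_def)
qed

lemma L2_norm_le_L2_vec_norm:
  assumes f: "f \<in> L2_vec n T" and k: "k \<in> {1..n}"
  shows "L2_norm T (f k) \<le> L2_vec_norm n T f"
  unfolding L2_norm_def L2_vec_norm_def
proof (intro real_sqrt_le_mono integral_mono)
  have i: "integrable (lebesgue_on {0<..<T}) (\<lambda>t. (f j t)\<^sup>2)" if "j \<in> {1..n}" for j
    using f that by (auto simp: L2_vec_def L2_def)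
  then show "integrable (lebesgue_on {0<..<T}) (\<lambda>t. (f k t)\<^sup>2)" using k by blast
  show "integrable (lebesgue_on {0<..<T}) (\<lambda>t. \<Sum>k=1..n. (f k t)\<^sup>2)"
    by (intro Bochner_Integration.integrable_sum i)
  show "(f k t)\<^sup>2 \<le> (\<Sum>k=1..n. (f k t)\<^sup>2)" for t
    using member_le_sum[of k "{1..n}" "\<lambda>k. (f k t)\<^sup>2"] k by simp
qed

lemma L2_lborel:
  assumes [measurable]: "g \<in> borel_measurable borel" and "integrable lborel (\<lambda>t. (g t)\<^sup>2)"
  shows "g \<in> L2 T"
  using assms(2) integrable_times_bounded[OF assms(2), of "indicator {0<..<T}" 1]
  by (auto simp: L2_def borel_measurable_lebesgue_on lebesgue_on_lborel mult.commute indicator_def)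

text \<open>Enlarging the domain to the whole line makes the right-hand side accessible to
  translation invariance.\<close>

lemma L2_vec_norm_le_lborel:
  assumes m: "\<And>k. k \<in> {1..n} \<Longrightarrow> g k \<in> borel_measurable borel"
    and int: "\<And>k. k \<in> {1..n} \<Longrightarrow> integrable lborel (\<lambda>t. (g k t)\<^sup>2)"
  shows "L2_vec_norm n T g \<le> sqrt (\<Sum>k=1..n. \<integral>t. (g k t)\<^sup>2 \<partial>lborel)"
  unfolding L2_vec_norm_def
proof (rule real_sqrt_le_mono)
  have i: "integrable (lebesgue_on {0<..<T}) (\<lambda>t. (g k t)\<^sup>2)" if "k \<in> {1..n}" for k
    using L2_lborel[OF m int, of k T] that by (simp add: L2_def)
  have m2: "(\<lambda>t. (g k t)\<^sup>2) \<in> borel_measurable borel" if "k \<in> {1..n}" for k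
    using m[OF that] by simp
  have "(LINT t|lebesgue_on {0<..<T}. (\<Sum>k=1..n. (g k t)\<^sup>2))
      = (\<Sum>k=1..n. LINT t|lebesgue_on {0<..<T}. (g k t)\<^sup>2)"
    by (rule Bochner_Integration.integral_sum[OF i])
  also have "\<dots> \<le> (\<Sum>k=1..n. \<integral>t. (g k t)\<^sup>2 \<partial>lborel)"
  proof (rule sum_mono)
    fix k assume k: "k \<in> {1..n}"
    show "(LINT t|lebesgue_on {0<..<T}. (g k t)\<^sup>2) \<le> (\<integral>t. (g k t)\<^sup>2 \<partial>lborel)"
      unfolding lebesgue_on_lborel(2)[OF m2[OF k]]
    proof (rule integral_mono)
      show "integrable lborel (\<lambda>t. indicator {0<..<T} t * (g k t)\<^sup>2)"
        using i[OF k] lebesgue_on_lborel(1)[OF m2[OF k]] by blast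
    qed (use int[OF k] in \<open>auto simp: indicator_def\<close>)
  qed
  finally show "(LINT t|lebesgue_on {0<..<T}. (\<Sum>k=1..n. (g k t)\<^sup>2))
      \<le> (\<Sum>k=1..n. \<integral>t. (g k t)\<^sup>2 \<partial>lborel)" .
qed

text \<open>On \<open>{0<..<T}\<close> the L1 norm is at most \<open>sqrt T\<close> times the L2
  norm. Since \<open>z\<close> and \<open>w\<close> agree a.e. in \<open>t\<close> for every single
  \<open>x\<close>, integrability and continuity in \<open>x\<close> pass from \<open>z\<close> to
  \<open>w\<close>.\<close>

lemma C_L2_L1_curve:
  assumes z: "z \<in> C_L2 n T \<omega>" and w: "jointly_measurable_version n T \<omega> z w"
    and k: "k \<in> {1..n}" and "0 < T"
  shows "L1_curve T \<omega> (\<lambda>t x. indicator {0<..<T} t * w k t x)"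
proof -
  have wm: "(\<lambda>(t, x). w k t x) \<in> borel_measurable (borel \<Otimes>\<^sub>M borel)"
    using w k unfolding jointly_measurable_version_def borel_prod by blast
  note [measurable] = wm
  have wx: "(\<lambda>t. w k t x) \<in> borel_measurable borel" for x by measurable
  have ae: "AE t in lebesgue_on {0<..<T}. z k t x = w k t x" if "x \<in> {0..\<omega>}" for x
    using w k that unfolding jointly_measurable_version_def C_L2_eq_def by blast
  have zL2: "(\<lambda>t. z k t x) \<in> L2 T" if "x \<in> {0..\<omega>}" for x
    using z k that by (auto simp: C_L2_def L2_vec_def)
  show ?thesis
    unfolding L1_curve_def
  proof (intro conjI allI ballI impI)
    show "(\<lambda>(t, x). indicator {0<..<T} t * w k t x) \<in> borel_measurable borel"
      unfolding borel_prod[symmetric] by measurable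
    show "indicator {0<..<T} t * w k t x = 0" if "t \<notin> {0<..<T}" for t x
      using that by simp
    show "integrable lborel (\<lambda>t. indicator {0<..<T} t * w k t x)" if x: "x \<in> {0..\<omega>}" for x
    proof -
      have "integrable (lebesgue_on {0<..<T}) (\<lambda>t. w k t x)"
        using L2_integrable[OF zL2[OF x]] integrable_cong_AE[OF _ _ ae[OF x]]
          borel_measurable_lebesgue_on[OF wx] borel_measurable_integrable by blast
      then show ?thesis using lebesgue_on_lborel(1)[OF wx] by blast
    qed
    fix X x assume x: "x \<in> {0..\<omega>}" and "\<forall>n. X n \<in> {0..\<omega>}" and X: "X \<longlonglongrightarrow> x"
    then have Xn: "X m \<in> {0..\<omega>}" for m by blast
    let ?N = "\<lambda>y. L2_vec_norm n T (\<lambda>k t. z k t y - z k t x)"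
    have "(?N \<longlongrightarrow> ?N x) (at x within {0..\<omega>})"
      using z x by (auto simp: C_L2_def L2_vec_norm_def)
    then have "(\<lambda>m. ?N (X m)) \<longlonglongrightarrow> ?N x"
      using continuous_within_tendsto_compose'[of x "{0..\<omega>}" ?N X sequentially] Xn X
      unfolding continuous_within by blast
    then have "(\<lambda>m. ?N (X m)) \<longlonglongrightarrow> 0" by (simp add: L2_vec_norm_def)
    then have lim: "(\<lambda>m. sqrt T * ?N (X m)) \<longlonglongrightarrow> 0" by (rule tendsto_mult_right_zero)
    have le: "(\<integral>t. \<bar>indicator {0<..<T} t * w k t (X m) - indicator {0<..<T} t * w k t x\<bar> \<partial>lborel)
        \<le> sqrt T * ?N (X m)" for m
    proof -
      have md: "(\<lambda>t. \<bar>w k t (X m) - w k t x\<bar>) \<in> borel_measurable borel"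
        using wx by measurable
      have d: "(\<lambda>t. z k t (X m) - z k t x) \<in> L2 T" by (rule L2_diff[OF zL2[OF Xn] zL2[OF x]])
      have "(\<integral>t. \<bar>indicator {0<..<T} t * w k t (X m) - indicator {0<..<T} t * w k t x\<bar> \<partial>lborel)
          = (\<integral>t. indicator {0<..<T} t * \<bar>w k t (X m) - w k t x\<bar> \<partial>lborel)"
        by (intro Bochner_Integration.integral_cong refl) (auto simp: indicator_def)
      also have "\<dots> = (LINT t|lebesgue_on {0<..<T}. \<bar>w k t (X m) - w k t x\<bar>)"
        by (rule lebesgue_on_lborel(2)[OF md, symmetric])
      also have "\<dots> = (LINT t|lebesgue_on {0<..<T}. \<bar>z k t (X m) - z k t x\<bar>)"
      proof (rule integral_cong_AE)
        show "AE t in lebesgue_on {0<..<T}. \<bar>w k t (X m) - w k t x\<bar> = \<bar>z k t (X m) - z k t x\<bar>"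
          using ae[OF Xn[of m]] ae[OF x] by eventually_elim simp
      qed (use d borel_measurable_lebesgue_on[OF md] in \<open>auto simp: L2_def\<close>)
      also have "\<dots> \<le> sqrt T * L2_norm T (\<lambda>t. z k t (X m) - z k t x)"
        by (rule L1_le_L2_norm[OF d \<open>0 < T\<close>])
      also have "\<dots> \<le> sqrt T * ?N (X m)"
      proof (rule mult_left_mono)
        have "(\<lambda>k t. z k t (X m) - z k t x) \<in> L2_vec n T"
          using z Xn[of m] x by (auto simp: C_L2_def L2_vec_def intro!: L2_diff)
        from L2_norm_le_L2_vec_norm[OF this k]
        show "L2_norm T (\<lambda>t. z k t (X m) - z k t x) \<le> ?N (X m)" .
      qed (use \<open>0 < T\<close> in simp)
      finally show ?thesis .
    qed
    show "(\<lambda>m. \<integral>t. \<bar>indicator {0<..<T} t * w k t (X m) - indicator {0<..<T} t * w k t x\<bar> \<partial>lborel) \<longlonglongrightarrow> 0"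
    proof (rule Lim_null_comparison[OF _ lim], rule always_eventually, rule allI)
      fix m
      have "0 \<le> (\<integral>t. \<bar>indicator {0<..<T} t * w k t (X m) - indicator {0<..<T} t * w k t x\<bar> \<partial>lborel)"
        by simp
      then show "norm (\<integral>t. \<bar>indicator {0<..<T} t * w k t (X m) - indicator {0<..<T} t * w k t x\<bar> \<partial>lborel)
          \<le> sqrt T * ?N (X m)" using le[of m] by simp
    qed
  qed
qed

text \<open>Two weak forms cannot be subtracted inside the iterated integral, because the inner
  integral in \<open>x\<close> need not exist for every \<open>t\<close>. As one integral over the
  product measure the weak form is linear in \<open>V\<close>.\<close>

lemma weak_form_eq_pair_integral:
  assumes curve: "L1_curve T \<omega> V" and pos: "0 < \<omega>" "0 < T"
    and P: "P \<in> borel_measurable borel" "\<forall>y. \<bar>P y\<bar> \<le> M"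
    and dP: "\<forall>t\<in>{0<..<T}. \<forall>x\<in>{0<..<\<omega>}. dt \<phi> t x + lam * dx \<phi> t x = P (t, x)"
  shows "integrable (lborel \<Otimes>\<^sub>M lborel) (\<lambda>(x, t). indicator {0<..<\<omega>} x * (V t x * P (t, x)))"
    and "(LINT t|lebesgue_on {0<..<T}. LINT x|lebesgue_on {0<..<\<omega>}. V t x * (dt \<phi> t x + lam * dx \<phi> t x))
      = (\<integral>(x, t). indicator {0<..<\<omega>} x * (V t x * P (t, x)) \<partial>(lborel \<Otimes>\<^sub>M lborel))"
proof -
  have [measurable]: "(\<lambda>(t, x). V t x) \<in> borel_measurable (borel \<Otimes>\<^sub>M borel)"
    by (rule L1_curveD(1)[OF curve])
  have [measurable]: "P \<in> borel_measurable (borel \<Otimes>\<^sub>M borel)"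
    using P by (simp add: borel_prod)
  let ?F = "\<lambda>x t. indicator {0<..<\<omega>} x * (V t x * P (t, x))"
  show int: "integrable (lborel \<Otimes>\<^sub>M lborel) (\<lambda>(x, t). ?F x t)"
    by (rule L1_curve_pair_integrable[OF curve pos(1), of "\<lambda>x t. P (t, x)" M]) (measurable, use P in blast)
  have "(LINT t|lebesgue_on {0<..<T}. LINT x|lebesgue_on {0<..<\<omega>}. V t x * (dt \<phi> t x + lam * dx \<phi> t x))
      = (LINT t|lebesgue_on {0<..<T}. LINT x|lebesgue_on {0<..<\<omega>}. V t x * P (t, x))"
    by (intro Bochner_Integration.integral_cong refl) (use dP in auto)
  also have "\<dots> = (LINT t|lebesgue_on {0<..<T}. (\<integral>x. ?F x t \<partial>lborel))"
    by (intro Bochner_Integration.integral_cong refl lebesgue_on_lborel) measurable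
  also have "\<dots> = (\<integral>t. indicator {0<..<T} t * (\<integral>x. ?F x t \<partial>lborel) \<partial>lborel)"
    by (intro lebesgue_on_lborel) measurable
  also have "\<dots> = (\<integral>t. (\<integral>x. ?F x t \<partial>lborel) \<partial>lborel)"
  proof (rule Bochner_Integration.integral_cong[OF refl])
    fix t
    show "indicator {0<..<T} t * (\<integral>x. ?F x t \<partial>lborel) = (\<integral>x. ?F x t \<partial>lborel)"
      by (cases "t \<in> {0<..<T}") (simp_all add: L1_curveD(2)[OF curve])
  qed
  also have "\<dots> = (\<integral>(x, t). ?F x t \<partial>(lborel \<Otimes>\<^sub>M lborel))"
    by (rule lborel_pair.integral_snd[OF int])
  finally show "(LINT t|lebesgue_on {0<..<T}. LINT x|lebesgue_on {0<..<\<omega>}. V t x * (dt \<phi> t x + lam * dx \<phi> t x))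
      = (\<integral>(x, t). ?F x t \<partial>(lborel \<Otimes>\<^sub>M lborel))" .
qed

lemma L1_curve_weak_unique:
  assumes V: "L1_curve T \<omega> V" and U: "L1_curve T \<omega> U"
    and pos: "0 < lam" "0 < \<omega>" "0 < T"
    and weak: "\<And>\<phi>. \<phi> \<in> test_functions \<omega> T \<Longrightarrow>
      (LINT t|lebesgue_on {0<..<T}. LINT x|lebesgue_on {0<..<\<omega>}. V t x * (dt \<phi> t x + lam * dx \<phi> t x))
      = (LINT t|lebesgue_on {0<..<T}. LINT x|lebesgue_on {0<..<\<omega>}. U t x * (dt \<phi> t x + lam * dx \<phi> t x))"
    and x: "x \<in> {0..\<omega>}"
  shows "AE t in lborel. V t x = U t x"
proof -
  have D: "L1_curve T \<omega> (\<lambda>t x. V t x - U t x)" by (rule L1_curve_diff[OF V U])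
  have "(LINT t|lebesgue_on {0<..<T}. LINT x|lebesgue_on {0<..<\<omega>}.
      (V t x - U t x) * (dt \<phi> t x + lam * dx \<phi> t x)) = 0" if phi: "\<phi> \<in> test_functions \<omega> T" for \<phi>
  proof -
    have C1: "\<phi> \<in> C1_closure ({0<..<T} \<times> {0<..<\<omega>})" using phi by (simp add: test_functions_def)
    obtain P M where P: "P \<in> borel_measurable borel" "\<forall>y. \<bar>P y\<bar> \<le> M"
      and dP: "\<forall>t\<in>{0<..<T}. \<forall>x\<in>{0<..<\<omega>}. dt \<phi> t x + lam * dx \<phi> t x = P (t, x)"
      by (rule C1_closure_bounded_derivative[OF C1 pos(3) pos(2) pos(1)], rule that)
    note W = weak_form_eq_pair_integral[OF _ pos(2) pos(3) P dP]
    have "(\<integral>(x, t). indicator {0<..<\<omega>} x * ((V t x - U t x) * P (t, x)) \<partial>(lborel \<Otimes>\<^sub>M lborel))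
        = (\<integral>y. (case y of (x, t) \<Rightarrow> indicator {0<..<\<omega>} x * (V t x * P (t, x)))
            - (case y of (x, t) \<Rightarrow> indicator {0<..<\<omega>} x * (U t x * P (t, x))) \<partial>(lborel \<Otimes>\<^sub>M lborel))"
      by (intro Bochner_Integration.integral_cong refl) (auto simp: algebra_simps)
    also have "\<dots> = 0"
      using weak[OF phi] unfolding W(2)[OF V] W(2)[OF U]
      by (subst Bochner_Integration.integral_diff[OF W(1)[OF V] W(1)[OF U]]) simp
    finally show ?thesis unfolding W(2)[OF D] .
  qed
  from transport_weak_unique[OF pos D this x] show ?thesis by simp
qed


section \<open>The solution on the network\<close>

text \<open>Exchanges an inflow or a trace for an a.e. equal one. Measurability of
  \<open>\<phi> (t, 0)\<close> comes from continuity on the rectangle.\<close>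

lemma boundary_integral_cong:
  assumes phi: "\<phi> \<in> test_functions \<omega> \<tau>" and \<tau>: "\<tau> \<le> T" and "0 < \<omega>"
    and m: "f \<in> borel_measurable (lebesgue_on {0<..<T})" "g \<in> borel_measurable (lebesgue_on {0<..<T})"
    and ae: "AE t in lebesgue_on {0<..<T}. f t = (g t :: real)"
  shows "(LINT t|lebesgue_on {0<..<\<tau>}. f t * \<phi> (t, 0)) = (LINT t|lebesgue_on {0<..<\<tau>}. g t * \<phi> (t, 0))"
proof (cases "0 < \<tau>")
  case True
  have "continuous_on ({0..\<tau>} \<times> {0..\<omega>}) \<phi>"
    using phi True \<open>0 < \<omega>\<close> by (simp add: test_functions_def C1_closure_def closure_Times)
  then have "continuous_on {0<..<\<tau>} (\<lambda>t. \<phi> (t, 0))"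
    by (rule continuous_on_compose2) (use \<open>0 < \<omega>\<close> in \<open>auto intro!: continuous_intros\<close>)
  then have "(\<lambda>t. \<phi> (t, 0)) \<in> borel_measurable (lebesgue_on {0<..<\<tau>})"
    by (rule continuous_imp_measurable_on_sets_lebesgue) simp
  moreover have "f \<in> borel_measurable (lebesgue_on {0<..<\<tau>})" "g \<in> borel_measurable (lebesgue_on {0<..<\<tau>})"
    using m \<tau> by (auto elim!: measurable_restrict_mono)
  moreover have "AE t in lebesgue_on {0<..<\<tau>}. f t * \<phi> (t, 0) = g t * \<phi> (t, 0)"
    using ae \<tau> unfolding AE_lebesgue_on_iff by (auto elim: eventually_mono)
  ultimately show ?thesis by (intro integral_cong_AE borel_measurable_times)
qed simp

text \<open>\<open>c\<close> and \<open>d\<close> are parameters because they depend on the network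
  alone: they are constructed before \<open>u\<close> is chosen, so a bound expressed through
  \<open>c\<close> is uniform in \<open>u\<close>. \<open>u0\<close> is the Borel version of
  \<open>u\<close>, extended by zero.\<close>

locale network_inflow = tree_network +
  fixes T \<omega> :: real and c d :: "nat \<Rightarrow> real" and u u0 :: "real \<Rightarrow> real"
  assumes T_pos: "0 < T" and \<omega>_pos: "0 < \<omega>"
    and root_coeffs: "c 1 = 1 / lam 1" "d 1 = 0"
    and child_coeffs: "\<And>i k. i \<in> inner_vertices G \<Longrightarrow> (i, k) \<in> out_arcs (with_proj G) i \<Longrightarrow>
      c k = al i k * (lam i / lam k) * c i \<and> d k = d i + \<omega> / lam i"
    and u_L2: "u \<in> L2 T"
    and u0_borel: "u0 \<in> borel_measurable borel"
    and u0_zero: "\<And>t. t \<notin> {0<..<T} \<Longrightarrow> u0 t = 0"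
    and u0_AE: "AE t in lebesgue_on {0<..<T}. u t = u0 t"
    and u0_square: "integrable lborel (\<lambda>t. (u0 t)\<^sup>2)"
    and u0_norm: "(\<integral>t. (u0 t)\<^sup>2 \<partial>lborel) = (L2_norm T u)\<^sup>2"
begin

text \<open>
  Unrolling the recursion for the solution: along the path from the source to \<open>v\<^sub>k\<close> the inflow
  is scaled by \<open>c k\<close> and delayed by the travel time \<open>d k\<close> to the start of the edge \<open>(k)\<close>.
\<close>

definition Z :: "nat \<Rightarrow> real \<Rightarrow> real \<Rightarrow> real" where
  "Z k t x = c k * u0 (t - d k - x / lam k)"

lemma delay_nonneg: "k \<in> {1..n} \<Longrightarrow> 0 \<le> d k"
proof (induction k rule: tree_induct)
  case (child i k)
  then show ?case using child_coeffs[of i k] velocity_pos[of i] \<omega>_pos by (simp add: add_nonneg_nonneg)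
qed (simp add: root_coeffs del: One_nat_def)

text \<open>Causality: delays are nonnegative, so \<open>u0\<close> is evaluated at a nonpositive
  time.\<close>

lemma Z_zero:
  assumes "k \<in> {1..n}" "t - x / lam k \<le> 0"
  shows "Z k t x = 0"
  using assms delay_nonneg[OF assms(1)] u0_zero by (simp add: Z_def)

lemma Z_zero_nonpos:
  assumes "k \<in> {1..n}" "t \<le> 0" "0 \<le> x"
  shows "Z k t x = 0"
proof (rule Z_zero[OF assms(1)])
  have "0 \<le> x / lam k" using assms velocity_pos[of k] by simp
  then show "t - x / lam k \<le> 0" using assms by linarith
qed

lemma Z_root: "Z 1 t x = 1 / lam 1 * u0 (t - x / lam 1)"
  by (simp add: Z_def root_coeffs del: One_nat_def)

text \<open>The parent's trace at \<open>\<omega>\<close> adds its travel time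
  \<open>\<omega> / lam i\<close> to the delay. With \<open>u0\<close> extended by zero, the
  recursion holds pointwise and without case distinction.\<close>

lemma Z_child:
  assumes "i \<in> inner_vertices G" "(i, k) \<in> out_arcs (with_proj G) i"
  shows "Z k t x = al i k * (lam i / lam k) * Z i (t - x / lam k) \<omega>"
proof -
  have c: "c k = al i k * (lam i / lam k) * c i" and "d k = d i + \<omega> / lam i"
    using child_coeffs[OF assms] by auto
  then have t: "t - d k - x / lam k = t - x / lam k - d i - \<omega> / lam i" by simp
  show ?thesis unfolding Z_def t c by (simp only: mult.assoc)
qed

lemma arc_bounds:
  assumes "i \<in> inner_vertices G" "(i, k) \<in> out_arcs (with_proj G) i"
  shows "i \<in> {1..n}" "k \<in> {1..n}"
proof -
  have "(i, k) \<in> parcs G" "i \<noteq> 0" using inner_arc_iff[of i k] assms by auto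
  then show "i \<in> {1..n}" "k \<in> {1..n}" using parcs_bounds[of i k] by auto
qed

lemma root_formula_AE:
  assumes "0 \<le> x"
  shows "AE t in lebesgue_on {0<..<T}.
    (if t - x / lam 1 > 0 then 1 / lam 1 * u (t - x / lam 1) else 0) = Z 1 t x"
  unfolding Z_root
proof (rule AE_lebesgue_on_delay[OF u0_AE])
  show "0 \<le> x / lam 1" using assms velocity_pos[of 1] n_pos by simp
qed (simp add: u0_zero)

lemma child_formula_AE:
  assumes arc: "i \<in> inner_vertices G" "(i, k) \<in> out_arcs (with_proj G) i" and "0 \<le> x"
    and ae: "AE t in lebesgue_on {0<..<T}. z i t \<omega> = Z i t \<omega>"
  shows "AE t in lebesgue_on {0<..<T}.
    (if t - x / lam k > 0 then al i k * (lam i / lam k) * z i (t - x / lam k) \<omega> else 0) = Z k t x"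
  unfolding Z_child[OF arc]
proof (rule AE_lebesgue_on_delay[OF ae])
  show "0 \<le> x / lam k" using assms velocity_pos[of k] arc_bounds[OF arc] by simp
  show "Z i s \<omega> = 0" if "s \<le> 0" for s
    using Z_zero_nonpos[OF arc_bounds(1)[OF arc] that] \<omega>_pos by simp
qed

lemma solution_formula_Z: "solution_formula G lam al T \<omega> u Z"
  unfolding solution_formula_def
proof (intro conjI ballI allI impI)
  show "AE t in lebesgue_on {0<..<T}.
      Z 1 t x = (if t - x / lam 1 > 0 then 1 / lam 1 * u (t - x / lam 1) else 0)"
    if "x \<in> {0..\<omega>}" for x
    using root_formula_AE[of x] that by (auto elim: eventually_mono)
  show "AE t in lebesgue_on {0<..<T}.
      Z k t x = (if t - x / lam k > 0 then al i k * (lam i / lam k) * Z i (t - x / lam k) \<omega> else 0)"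
    if "i \<in> inner_vertices G" "(i, k) \<in> out_arcs (with_proj G) i" "x \<in> {0..\<omega>}" for i k x
    using child_formula_AE[OF that(1,2), of x Z] that(3) by (auto elim: eventually_mono)
qed

text \<open>The recursion reads the parent only at \<open>x = \<omega>\<close>, so a.e. equality for
  each fixed \<open>x\<close> is a sufficient induction hypothesis.\<close>

lemma solution_formula_unique:
  assumes z: "solution_formula G lam al T \<omega> u z"
  shows "C_L2_eq n T \<omega> z Z"
proof -
  have "\<forall>x\<in>{0..\<omega>}. AE t in lebesgue_on {0<..<T}. z k t x = Z k t x" if "k \<in> {1..n}" for k
    using that
  proof (induction k rule: tree_induct)
    case root
    show ?case
    proof
      fix x assume x: "x \<in> {0..\<omega>}"
      then have "AE t in lebesgue_on {0<..<T}.
          z 1 t x = (if t - x / lam 1 > 0 then 1 / lam 1 * u (t - x / lam 1) else 0)"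
        using z by (simp add: solution_formula_def)
      then show "AE t in lebesgue_on {0<..<T}. z 1 t x = Z 1 t x"
        using root_formula_AE[of x] x by (auto elim: eventually_elim2)
    qed
  next
    case (child i k)
    show ?case
    proof
      fix x assume x: "x \<in> {0..\<omega>}"
      then have "AE t in lebesgue_on {0<..<T}.
          z k t x = (if t - x / lam k > 0 then al i k * (lam i / lam k) * z i (t - x / lam k) \<omega> else 0)"
        using z child(1,2) by (simp add: solution_formula_def)
      moreover have "AE t in lebesgue_on {0<..<T}. z i t \<omega> = Z i t \<omega>"
        using child.IH \<omega>_pos by simp
      ultimately show "AE t in lebesgue_on {0<..<T}. z k t x = Z k t x"
        using child_formula_AE[OF child(1,2), of x z] x by (auto elim: eventually_elim2)
    qed
  qed
  then show ?thesis by (simp add: C_L2_eq_def)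
qed

section \<open>The explicit solution as a continuous curve in L2, and its norm\<close>

lemma Z_borel_pair: "(\<lambda>(t, x). Z k t x) \<in> borel_measurable borel"
  using u0_borel unfolding borel_prod[symmetric] Z_def by measurable

lemma Z_borel: "(\<lambda>t. Z k t x) \<in> borel_measurable borel"
  using u0_borel unfolding Z_def by measurable

lemma u0_integrable: "integrable lborel u0"
proof -
  have "integrable lborel (\<lambda>t. indicator {0<..<T} t * u0 t)"
    using L2_integrable[OF L2_lborel[OF u0_borel u0_square, of T]] lebesgue_on_lborel(1)[OF u0_borel] by blast
  moreover have "indicator {0<..<T} t * u0 t = u0 t" for t
    using u0_zero[of t] by (cases "t \<in> {0<..<T}") auto
  ultimately show ?thesis by simp
qed

lemma Z_integrable: "integrable lborel (\<lambda>t. Z k t x)"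
  using lborel_integrable_real_affine[OF u0_integrable, of 1 "- d k - x / lam k"]
  by (simp add: Z_def algebra_simps)

lemma Z_square:
  shows "integrable lborel (\<lambda>t. (Z k t x)\<^sup>2)"
    and "(\<integral>t. (Z k t x)\<^sup>2 \<partial>lborel) = (c k)\<^sup>2 * (L2_norm T u)\<^sup>2"
proof -
  have eq: "(Z k t x)\<^sup>2 = (c k)\<^sup>2 * (u0 ((- d k - x / lam k) + 1 * t))\<^sup>2" for t
    by (simp add: Z_def power_mult_distrib algebra_simps)
  show "integrable lborel (\<lambda>t. (Z k t x)\<^sup>2)"
    unfolding eq using lborel_integrable_real_affine[OF u0_square, of 1 "- d k - x / lam k"] by simp
  show "(\<integral>t. (Z k t x)\<^sup>2 \<partial>lborel) = (c k)\<^sup>2 * (L2_norm T u)\<^sup>2"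
    unfolding eq u0_norm[symmetric]
    using lborel_integral_real_affine[of 1 "\<lambda>t. (u0 t)\<^sup>2" "- d k - x / lam k"] by simp
qed

text \<open>Moving time by the common delay at \<open>y\<close> turns the difference into that of
  \<open>u0\<close> and its translate by \<open>(x - y) / lam k\<close>, the form needed for
  \<open>L2_translation_continuous\<close>.\<close>

lemma Z_diff_square:
  shows "integrable lborel (\<lambda>t. (Z k t x - Z k t y)\<^sup>2)"
    and "(\<integral>t. (Z k t x - Z k t y)\<^sup>2 \<partial>lborel)
      = (c k)\<^sup>2 * (\<integral>t. (u0 (t - (x - y) / lam k) - u0 t)\<^sup>2 \<partial>lborel)"
proof -
  let ?f = "\<lambda>t. (u0 (t - (x - y) / lam k) - u0 t)\<^sup>2"
  have eq: "(Z k t x - Z k t y)\<^sup>2 = (c k)\<^sup>2 * ?f ((- d k - y / lam k) + 1 * t)" for t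
  proof -
    have a: "- d k - y / lam k + 1 * t - (x - y) / lam k = t - d k - x / lam k"
      by (simp add: diff_divide_distrib)
    have b: "- d k - y / lam k + 1 * t = t - d k - y / lam k" by simp
    show ?thesis unfolding a unfolding b Z_def by (simp add: power2_eq_square algebra_simps)
  qed
  have m: "?f \<in> borel_measurable borel" using u0_borel by measurable
  have "integrable lborel (\<lambda>t. (u0 (t - (x - y) / lam k))\<^sup>2)"
    using lborel_integrable_real_affine[OF u0_square, of 1 "- ((x - y) / lam k)"] by simp
  then have i: "integrable lborel (\<lambda>t. 2 * (u0 (t - (x - y) / lam k))\<^sup>2 + 2 * (u0 t)\<^sup>2)"
    using u0_square by simp
  have int: "integrable lborel ?f"
    by (rule Bochner_Integration.integrable_bound[OF i]) (use m diff_squared_le in auto)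
  show "integrable lborel (\<lambda>t. (Z k t x - Z k t y)\<^sup>2)"
    unfolding eq using lborel_integrable_real_affine[OF int, of 1 "- d k - y / lam k"] by simp
  show "(\<integral>t. (Z k t x - Z k t y)\<^sup>2 \<partial>lborel) = (c k)\<^sup>2 * (\<integral>t. ?f t \<partial>lborel)"
    unfolding eq using lborel_integral_real_affine[of 1 ?f "- d k - y / lam k"] by simp
qed

lemma Z_C_L2: "Z \<in> C_L2 n T \<omega>"
  unfolding C_L2_def
proof (intro CollectI conjI ballI)
  show "(\<lambda>k t. Z k t x) \<in> L2_vec n T" for x
    by (auto simp: L2_vec_def intro!: L2_lborel Z_borel Z_square)
  fix x0 assume "x0 \<in> {0..\<omega>}"
  show "((\<lambda>x. L2_vec_norm n T (\<lambda>k t. Z k t x - Z k t x0)) \<longlongrightarrow> 0) (at x0 within {0..\<omega>})"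
    unfolding tendsto_at_iff_sequentially
  proof (intro allI impI)
    fix X assume X: "X \<longlonglongrightarrow> x0"
    let ?S = "\<lambda>m. \<Sum>k=1..n. \<integral>t. (Z k t (X m) - Z k t x0)\<^sup>2 \<partial>lborel"
    have "(\<lambda>m. \<integral>t. (Z k t (X m) - Z k t x0)\<^sup>2 \<partial>lborel) \<longlonglongrightarrow> 0" for k
    proof -
      have "(\<lambda>m. (X m - x0) / lam k) \<longlonglongrightarrow> 0"
        using X by (intro tendsto_divide_zero) (simp add: LIM_zero)
      from L2_translation_continuous[OF u0_borel u0_square this]
      show ?thesis unfolding Z_diff_square(2) by (rule tendsto_mult_right_zero)
    qed
    then have "?S \<longlonglongrightarrow> 0" by (intro tendsto_null_sum)
    then have lim: "(\<lambda>m. sqrt (?S m)) \<longlonglongrightarrow> 0" using tendsto_real_sqrt by fastforce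
    have le: "L2_vec_norm n T (\<lambda>k t. Z k t (X m) - Z k t x0) \<le> sqrt (?S m)" for m
      by (rule L2_vec_norm_le_lborel) (auto intro!: Z_diff_square borel_measurable_diff Z_borel)
    have nonneg: "0 \<le> L2_vec_norm n T f" for f
      by (simp add: L2_vec_norm_def sum_nonneg)
    show "((\<lambda>x. L2_vec_norm n T (\<lambda>k t. Z k t x - Z k t x0)) \<circ> X) \<longlonglongrightarrow> 0"
      unfolding o_def
      by (rule tendsto_sandwich[OF always_eventually[OF allI] always_eventually[OF allI] tendsto_const lim])
        (use le nonneg in auto)
  qed
qed

text \<open>Each component is a translate of \<open>u0\<close> scaled by \<open>c k\<close>, so its
  squared norm on the whole line is \<open>(c k)\<^sup>2\<close> times that of
  \<open>u\<close>.\<close>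

lemma Z_norm_bound:
  "L2_vec_norm n T (\<lambda>k t. Z k t x) \<le> sqrt (\<Sum>k=1..n. (c k)\<^sup>2) * L2_norm T u"
proof -
  have "L2_vec_norm n T (\<lambda>k t. Z k t x) \<le> sqrt (\<Sum>k=1..n. \<integral>t. (Z k t x)\<^sup>2 \<partial>lborel)"
    by (rule L2_vec_norm_le_lborel) (auto intro!: Z_borel Z_square)
  also have "\<dots> = sqrt ((\<Sum>k=1..n. (c k)\<^sup>2) * (L2_norm T u)\<^sup>2)"
    by (simp add: Z_square(2) sum_distrib_right)
  also have "\<dots> = sqrt (\<Sum>k=1..n. (c k)\<^sup>2) * L2_norm T u"
    by (simp add: real_sqrt_mult L2_norm_def)
  finally show ?thesis .
qed

lemma C_L2_norm_bound:
  assumes z: "z \<in> C_L2 n T \<omega>" and eq: "C_L2_eq n T \<omega> z Z"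
  shows "C_L2_norm n T \<omega> z \<le> sqrt (\<Sum>k=1..n. (c k)\<^sup>2) * L2_norm T u"
  unfolding C_L2_norm_def
proof (rule cSUP_least)
  fix x assume x: "x \<in> {0..\<omega>}"
  have "AE t in lebesgue_on {0<..<T}. \<forall>k\<in>{1..n}. z k t x = Z k t x"
    using eq x by (intro AE_finite_allI) (auto simp: C_L2_eq_def)
  then have ae: "AE t in lebesgue_on {0<..<T}. (\<Sum>k=1..n. (z k t x)\<^sup>2) = (\<Sum>k=1..n. (Z k t x)\<^sup>2)"
    by eventually_elim simp
  have "(LINT t|lebesgue_on {0<..<T}. (\<Sum>k=1..n. (z k t x)\<^sup>2))
      = (LINT t|lebesgue_on {0<..<T}. (\<Sum>k=1..n. (Z k t x)\<^sup>2))"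
  proof (rule integral_cong_AE[OF _ _ ae])
    show "(\<lambda>t. \<Sum>k=1..n. (z k t x)\<^sup>2) \<in> borel_measurable (lebesgue_on {0<..<T})"
      using z x by (intro borel_measurable_sum borel_measurable_power) (auto simp: C_L2_def L2_vec_def L2_def)
    show "(\<lambda>t. \<Sum>k=1..n. (Z k t x)\<^sup>2) \<in> borel_measurable (lebesgue_on {0<..<T})"
      by (intro borel_measurable_sum borel_measurable_power borel_measurable_lebesgue_on Z_borel)
  qed
  then have "L2_vec_norm n T (\<lambda>k t. z k t x) = L2_vec_norm n T (\<lambda>k t. Z k t x)"
    by (simp add: L2_vec_norm_def)
  then show "L2_vec_norm n T (\<lambda>k t. z k t x) \<le> sqrt (\<Sum>k=1..n. (c k)\<^sup>2) * L2_norm T u"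
    using Z_norm_bound by simp
qed (use \<omega>_pos in simp)

section \<open>Weak formulation and uniqueness on the network\<close>

lemma Z_weak_root:
  assumes \<tau>: "\<tau> \<in> {0..T}" and phi: "\<phi> \<in> test_functions \<omega> \<tau>"
  shows "(LINT t|lebesgue_on {0<..<\<tau>}. LINT x|lebesgue_on {0<..<\<omega>}. Z 1 t x * (dt \<phi> t x + lam 1 * dx \<phi> t x))
    = - (LINT t|lebesgue_on {0<..<\<tau>}. u t * \<phi> (t, 0))"
proof -
  have l: "0 < lam 1" using velocity_pos[of 1] n_pos by simp
  have "(LINT t|lebesgue_on {0<..<\<tau>}. LINT x|lebesgue_on {0<..<\<omega>}. Z 1 t x * (dt \<phi> t x + lam 1 * dx \<phi> t x))
      = - (lam 1 * (LINT t|lebesgue_on {0<..<\<tau>}. 1 / lam 1 * u0 t * \<phi> (t, 0)))"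
    unfolding Z_root
    by (rule transport_weak_form[where g = "\<lambda>t. 1 / lam 1 * u0 t"])
      (use u0_borel u0_integrable u0_zero l \<omega>_pos \<tau> phi in auto)
  also have "\<dots> = - (LINT t|lebesgue_on {0<..<\<tau>}. u0 t * \<phi> (t, 0))"
    using l by simp
  also have "(LINT t|lebesgue_on {0<..<\<tau>}. u0 t * \<phi> (t, 0)) = (LINT t|lebesgue_on {0<..<\<tau>}. u t * \<phi> (t, 0))"
    by (rule boundary_integral_cong[OF phi _ \<omega>_pos, of T, symmetric])
      (use \<tau> u_L2 u0_AE borel_measurable_lebesgue_on[OF u0_borel] in \<open>auto simp: L2_def\<close>)
  finally show ?thesis .
qed

text \<open>Stated for any \<open>f\<close> that is a.e. the parent's trace, because the weak
  formulation has the trace of the given \<open>z\<close> on its right-hand side. It serves both the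
  existence proof and the uniqueness induction.\<close>

lemma Z_weak_child:
  assumes arc: "i \<in> inner_vertices G" "(i, k) \<in> out_arcs (with_proj G) i"
    and \<tau>: "\<tau> \<in> {0..T}" and phi: "\<phi> \<in> test_functions \<omega> \<tau>"
    and f: "f \<in> borel_measurable (lebesgue_on {0<..<T})"
    and ae: "AE t in lebesgue_on {0<..<T}. f t = Z i t \<omega>"
  shows "(LINT t|lebesgue_on {0<..<\<tau>}. LINT x|lebesgue_on {0<..<\<omega>}. Z k t x * (dt \<phi> t x + lam k * dx \<phi> t x))
    = - (al i k * lam i * (LINT t|lebesgue_on {0<..<\<tau>}. f t * \<phi> (t, 0)))"
proof -
  have l: "0 < lam k" using velocity_pos arc_bounds[OF arc] by simp
  have "(LINT t|lebesgue_on {0<..<\<tau>}. LINT x|lebesgue_on {0<..<\<omega>}. Z k t x * (dt \<phi> t x + lam k * dx \<phi> t x))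
      = - (lam k * (LINT t|lebesgue_on {0<..<\<tau>}. al i k * (lam i / lam k) * Z i t \<omega> * \<phi> (t, 0)))"
    unfolding Z_child[OF arc]
    by (rule transport_weak_form[where g = "\<lambda>t. al i k * (lam i / lam k) * Z i t \<omega>"])
      (use Z_borel[of i \<omega>] Z_integrable[of i \<omega>] Z_zero_nonpos[OF arc_bounds(1)[OF arc]] l \<omega>_pos \<tau> phi in auto)
  also have "(LINT t|lebesgue_on {0<..<\<tau>}. al i k * (lam i / lam k) * Z i t \<omega> * \<phi> (t, 0))
      = al i k * (lam i / lam k) * (LINT t|lebesgue_on {0<..<\<tau>}. Z i t \<omega> * \<phi> (t, 0))"
    by (simp only: mult.assoc integral_mult_right_zero)
  also have "- (lam k * (al i k * (lam i / lam k) * (LINT t|lebesgue_on {0<..<\<tau>}. Z i t \<omega> * \<phi> (t, 0))))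
      = - (al i k * lam i * (LINT t|lebesgue_on {0<..<\<tau>}. Z i t \<omega> * \<phi> (t, 0)))"
    using l by simp
  also have "(LINT t|lebesgue_on {0<..<\<tau>}. Z i t \<omega> * \<phi> (t, 0)) = (LINT t|lebesgue_on {0<..<\<tau>}. f t * \<phi> (t, 0))"
    by (rule boundary_integral_cong[OF phi _ \<omega>_pos f _ ae, symmetric])
      (use \<tau> borel_measurable_lebesgue_on[OF Z_borel] in auto)
  finally show ?thesis .
qed

text \<open>\<open>Z\<close> is Borel in \<open>(t, x)\<close> and can itself be the jointly
  measurable version of \<open>z\<close>.\<close>

lemma weak_solution_if_eq_Z:
  assumes z: "z \<in> C_L2 n T \<omega>" and eq: "C_L2_eq n T \<omega> z Z"
  shows "weak_solution G n lam al T \<omega> u z"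
  unfolding weak_solution_def
proof (intro conjI exI[of _ Z] ballI allI impI z)
  show "jointly_measurable_version n T \<omega> z Z"
    using eq Z_borel_pair by (simp add: jointly_measurable_version_def)
  fix \<tau> \<phi> assume \<tau>: "\<tau> \<in> {0..T}" and phi: "\<phi> \<in> test_functions \<omega> \<tau>"
  show "(LINT t|lebesgue_on {0<..<\<tau>}. LINT x|lebesgue_on {0<..<\<omega>}. Z 1 t x * (dt \<phi> t x + lam 1 * dx \<phi> t x))
      = - (LINT t|lebesgue_on {0<..<\<tau>}. u t * \<phi> (t, 0))"
    by (rule Z_weak_root[OF \<tau> phi])
  fix i k assume arc: "i \<in> inner_vertices G" "(i, k) \<in> out_arcs (with_proj G) i"
  note i = arc_bounds(1)[OF arc]
  have "(\<lambda>t. z i t \<omega>) \<in> borel_measurable (lebesgue_on {0<..<T})"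
    using z i \<omega>_pos by (auto simp: C_L2_def L2_vec_def L2_def)
  moreover have "AE t in lebesgue_on {0<..<T}. z i t \<omega> = Z i t \<omega>"
    using eq i \<omega>_pos by (simp add: C_L2_eq_def)
  ultimately show "(LINT t|lebesgue_on {0<..<\<tau>}. LINT x|lebesgue_on {0<..<\<omega>}. Z k t x * (dt \<phi> t x + lam k * dx \<phi> t x))
      = - (al i k * lam i * (LINT t|lebesgue_on {0<..<\<tau>}. z i t \<omega> * \<phi> (t, 0)))"
    by (rule Z_weak_child[OF arc \<tau> phi])
qed

text \<open>Once \<open>z i\<close> and \<open>Z i\<close> have a.e. equal traces, the boundary
  terms of the child edge coincide, so \<open>w k\<close> and \<open>Z k\<close> have the same weak
  form and one-edge uniqueness at final time \<open>T\<close> applies.\<close>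

lemma weak_solution_unique:
  assumes z: "weak_solution G n lam al T \<omega> u z"
  shows "C_L2_eq n T \<omega> z Z"
proof -
  obtain w where zC: "z \<in> C_L2 n T \<omega>" and w: "jointly_measurable_version n T \<omega> z w"
    and weak_root: "\<And>\<phi>. \<phi> \<in> test_functions \<omega> T \<Longrightarrow>
      (LINT t|lebesgue_on {0<..<T}. LINT x|lebesgue_on {0<..<\<omega>}. w 1 t x * (dt \<phi> t x + lam 1 * dx \<phi> t x))
        = - (LINT t|lebesgue_on {0<..<T}. u t * \<phi> (t, 0))"
    and weak_child: "\<And>\<phi> i k. \<phi> \<in> test_functions \<omega> T \<Longrightarrow> i \<in> inner_vertices G \<Longrightarrow>
      (i, k) \<in> out_arcs (with_proj G) i \<Longrightarrow>
      (LINT t|lebesgue_on {0<..<T}. LINT x|lebesgue_on {0<..<\<omega>}. w k t x * (dt \<phi> t x + lam k * dx \<phi> t x))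
        = - (al i k * lam i * (LINT t|lebesgue_on {0<..<T}. z i t \<omega> * \<phi> (t, 0)))"
  proof -
    have "T \<in> {0..T}" using T_pos by simp
    then show ?thesis
      using z that unfolding weak_solution_def by blast
  qed
  have zw: "AE t in lebesgue_on {0<..<T}. z k t x = w k t x" if "k \<in> {1..n}" "x \<in> {0..\<omega>}" for k x
    using w that unfolding jointly_measurable_version_def C_L2_eq_def by blast
  have ZZ: "jointly_measurable_version n T \<omega> Z Z"
    using Z_borel_pair by (simp add: jointly_measurable_version_def C_L2_eq_def)
  have step: "\<forall>x\<in>{0..\<omega>}. AE t in lebesgue_on {0<..<T}. z k t x = Z k t x"
    if k: "k \<in> {1..n}" and eq: "\<And>\<phi>. \<phi> \<in> test_functions \<omega> T \<Longrightarrow>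
      (LINT t|lebesgue_on {0<..<T}. LINT x|lebesgue_on {0<..<\<omega>}. w k t x * (dt \<phi> t x + lam k * dx \<phi> t x))
      = (LINT t|lebesgue_on {0<..<T}. LINT x|lebesgue_on {0<..<\<omega>}. Z k t x * (dt \<phi> t x + lam k * dx \<phi> t x))" for k
  proof
    fix x assume x: "x \<in> {0..\<omega>}"
    \<comment> \<open>An \<open>L1_curve\<close> must vanish outside \<open>{0<..<T}\<close>; the
      indicator that ensures this is invisible to integrals over that interval.\<close>
    have cut: "(LINT t|lebesgue_on {0<..<T}. LINT x|lebesgue_on {0<..<\<omega>}.
        indicator {0<..<T} t * v t x * (dt \<phi> t x + lam k * dx \<phi> t x))
      = (LINT t|lebesgue_on {0<..<T}. LINT x|lebesgue_on {0<..<\<omega>}. v t x * (dt \<phi> t x + lam k * dx \<phi> t x))"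
      for v :: "real \<Rightarrow> real \<Rightarrow> real" and \<phi>
      by (rule Bochner_Integration.integral_cong[OF refl]) simp
    have "AE t in lborel. indicator {0<..<T} t * w k t x = indicator {0<..<T} t * Z k t x"
    proof (rule L1_curve_weak_unique[OF C_L2_L1_curve[OF zC w k T_pos] C_L2_L1_curve[OF Z_C_L2 ZZ k T_pos]
          velocity_pos[OF k] \<omega>_pos T_pos _ x])
      fix \<phi> assume "\<phi> \<in> test_functions \<omega> T"
      then show "(LINT t|lebesgue_on {0<..<T}. LINT x|lebesgue_on {0<..<\<omega>}.
          indicator {0<..<T} t * w k t x * (dt \<phi> t x + lam k * dx \<phi> t x))
        = (LINT t|lebesgue_on {0<..<T}. LINT x|lebesgue_on {0<..<\<omega>}.
          indicator {0<..<T} t * Z k t x * (dt \<phi> t x + lam k * dx \<phi> t x))"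
        unfolding cut by (rule eq)
    qed
    then have "AE t in lebesgue_on {0<..<T}. w k t x = Z k t x"
      unfolding AE_lebesgue_on_iff by eventually_elim (auto simp: indicator_def)
    then show "AE t in lebesgue_on {0<..<T}. z k t x = Z k t x"
      using zw[OF k x] by eventually_elim simp
  qed
  have "\<forall>x\<in>{0..\<omega>}. AE t in lebesgue_on {0<..<T}. z k t x = Z k t x" if "k \<in> {1..n}" for k
    using that
  proof (induction k rule: tree_induct)
    case root
    have "1 \<in> {1..n}" "T \<in> {0..T}" using n_pos T_pos by simp_all
    then show ?case using step[of 1] weak_root Z_weak_root by simp
  next
    case (child i k)
    have T: "T \<in> {0..T}" using T_pos by simp
    have "(\<lambda>t. z i t \<omega>) \<in> borel_measurable (lebesgue_on {0<..<T})"
      using zC child(3) \<omega>_pos by (auto simp: C_L2_def L2_vec_def L2_def)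
    moreover have "AE t in lebesgue_on {0<..<T}. z i t \<omega> = Z i t \<omega>"
      using child.IH \<omega>_pos by simp
    ultimately show ?case
      using step[OF child(4)] weak_child[OF _ child(1,2)] Z_weak_child[OF child(1,2) T] by simp
  qed
  then show ?thesis by (simp add: C_L2_eq_def)
qed

end

theorem proposition2p2:
  fixes G :: "nat pair_pre_digraph" and n :: nat
    and lam :: "nat \<Rightarrow> real" and al :: "nat \<Rightarrow> nat \<Rightarrow> real"
    and T \<omega> :: real
  assumes "tree_network G n lam al" and "0 < T" and "0 < \<omega>"
  shows "\<exists>\<kappa>>0. \<forall>u\<in>L2 T.
           (\<exists>z\<in>C_L2 n T \<omega>. solution_formula G lam al T \<omega> u z) \<and>
           (\<forall>z\<in>C_L2 n T \<omega>. solution_formula G lam al T \<omega> u z \<longrightarrow>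
              weak_solution G n lam al T \<omega> u z \<and>
              (\<forall>z'. weak_solution G n lam al T \<omega> u z' \<longrightarrow> C_L2_eq n T \<omega> z' z) \<and>
              C_L2_norm n T \<omega> z \<le> \<kappa> * L2_norm T u)"
proof -
  interpret tree_network G n lam al by (rule assms(1))
  \<comment> \<open>Pairs of scaling and delay, fixed before \<open>u\<close> enters.\<close>
  obtain F :: "nat \<Rightarrow> real \<times> real" where F1: "F 1 = (1 / lam 1, 0)"
    and Fk: "\<forall>i k. i \<in> inner_vertices G \<longrightarrow> (i, k) \<in> out_arcs (with_proj G) i \<longrightarrow>
      F k = (al i k * (lam i / lam k) * fst (F i), snd (F i) + \<omega> / lam i)"
    by (rule tree_recursion[where a = "(1 / lam 1, 0)"
        and s = "\<lambda>i k y. (al i k * (lam i / lam k) * fst y, snd y + \<omega> / lam i)"])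
  let ?\<kappa> = "sqrt (\<Sum>k=1..n. (fst (F k))\<^sup>2)"
  have \<kappa>: "0 \<le> ?\<kappa>" by (simp add: sum_nonneg)
  show ?thesis
  \<comment> \<open>Adding 1 makes the constant positive without examining the signs of the
    coefficients.\<close>
  proof (intro exI[of _ "?\<kappa> + 1"] conjI ballI allI impI)
    show "0 < ?\<kappa> + 1" using \<kappa> by linarith
    fix u assume u: "u \<in> L2 T"
    obtain u0 where u0: "u0 \<in> borel_measurable borel" "\<forall>t. t \<notin> {0<..<T} \<longrightarrow> u0 t = 0"
      "AE t in lebesgue_on {0<..<T}. u t = u0 t" "integrable lborel (\<lambda>t. (u0 t)\<^sup>2)"
      "(\<integral>t. (u0 t)\<^sup>2 \<partial>lborel) = (L2_norm T u)\<^sup>2"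
      by (rule L2_borel_version[OF u])
    interpret network_inflow G n lam al T \<omega> "\<lambda>k. fst (F k)" "\<lambda>k. snd (F k)" u u0
      by unfold_locales (use assms u u0 F1 Fk in auto)
    show "\<exists>z\<in>C_L2 n T \<omega>. solution_formula G lam al T \<omega> u z"
      using Z_C_L2 solution_formula_Z by blast
    fix z assume z: "z \<in> C_L2 n T \<omega>" and "solution_formula G lam al T \<omega> u z"
    then have eq: "C_L2_eq n T \<omega> z Z" by (intro solution_formula_unique)
    show "weak_solution G n lam al T \<omega> u z" by (rule weak_solution_if_eq_Z[OF z eq])
    have "C_L2_norm n T \<omega> z \<le> ?\<kappa> * L2_norm T u" by (rule C_L2_norm_bound[OF z eq])
    also have "\<dots> \<le> (?\<kappa> + 1) * L2_norm T u"
      by (intro mult_right_mono) (simp_all add: L2_norm_def)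
    finally show "C_L2_norm n T \<omega> z \<le> (?\<kappa> + 1) * L2_norm T u" .
    fix z' assume "weak_solution G n lam al T \<omega> u z'"
    then have "C_L2_eq n T \<omega> z' Z" by (rule weak_solution_unique)
    then have z': "AE t in lebesgue_on {0<..<T}. z' k t x = Z k t x" if "k \<in> {1..n}" "x \<in> {0..\<omega>}" for k x
      using that by (simp add: C_L2_eq_def)
    have zZ: "AE t in lebesgue_on {0<..<T}. z k t x = Z k t x" if "k \<in> {1..n}" "x \<in> {0..\<omega>}" for k x
      using eq that by (simp add: C_L2_eq_def)
    show "C_L2_eq n T \<omega> z' z"
      unfolding C_L2_eq_def
    proof (intro ballI)
      fix x k assume "x \<in> {0..\<omega>}" "k \<in> {1..n}"
      then show "AE t in lebesgue_on {0<..<T}. z' k t x = z k t x"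
        using z'[of k x] zZ[of k x] by (auto elim: eventually_elim2)
    qed
  qed
qed

end
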